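(* Let $q$ be a fixed prime power. The $n\to\infty$ limit of the probability that a uniformly random matrix in $Mat(n,q)$ is regular-semisimple is $$\prod_{r=1}^{\infty}\left(1-\frac{1}{q^r}\right).$$
   Context: $Mat(n,q)$ is the set of all $n\times n$ matrices over the finite field $F_q$. By rational canonical form, a matrix $\alpha\in Mat(n,q)$ determines for each monic non-constant irreducible polynomial $\phi$ over $F_q$ a partition $\lambda_\phi(\alpha)$ with parts $\lambda_{\phi,1}\ge\lambda_{\phi,2}\ge\cdots$, such that $F_q^n$, as an $F_q[z]$-module with $z$ acting as $\alpha$, is isomorphic to $\bigoplus_\phi\bigoplus_j F_q[z]/(\phi^{\lambda_{\phi,j}})$. A matrix $\alpha\in Mat(n,q)$ is called regular if every $\lambda_\phi(\alpha)$ has at most one part (equivalently, the minimal polynomial of $\alpha$ equals its characteristic polynomial). It is semisimple if it is diagonalizable over the algebraic closure of $F_q$, and regular-semisimple if it is both regular and semisimple. *)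

theory Defs
  imports
    "HOL-Probability.Probability_Mass_Function"
    "HOL-Analysis.Infinite_Products"
    "HOL-Number_Theory.Prime_Powers"
    "HOL-Algebra.Algebraic_Closure_Type"
    "Jordan_Normal_Form.Matrix"
begin

definition monic_irreducibles :: "'a::field poly set" where
  "monic_irreducibles = {\<phi>. Polynomial.lead_coeff \<phi> = 1 \<and> Factorial_Ring.irreducible \<phi>}"

definition partition_list :: "nat list \<Rightarrow> bool" where
  "partition_list ps \<longleftrightarrow> sorted_wrt (\<ge>) ps \<and> 0 \<notin> set ps"

text \<open>
  For a family of partitions \<open>lam\<close>, the module \<open>\<Oplus>\<^sub>\<phi> \<Oplus>\<^sub>j F[z]/(\<phi>^lam \<phi> ! j)\<close>. An element is a
  finitely supported family indexed by the pairs \<open>(\<phi>, j)\<close>; a residue class modulo \<open>m\<close> is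
  represented by its unique representative \<open>p\<close> with \<open>p mod m = p\<close>. On these representatives
  addition and scalar multiplication are those of polynomials, and \<open>z\<close> acts by
  \<open>p \<mapsto> (z * p) mod m\<close>.
\<close>

definition summand_index :: "('a::field poly \<Rightarrow> nat list) \<Rightarrow> ('a poly \<times> nat) set" where
  "summand_index lam = (SIGMA \<phi>:monic_irreducibles. {..<length (lam \<phi>)})"

definition summand_modulus :: "('a::field poly \<Rightarrow> nat list) \<Rightarrow> 'a poly \<times> nat \<Rightarrow> 'a poly" where
  "summand_modulus lam = (\<lambda>(\<phi>, j). \<phi> ^ (lam \<phi> ! j))"

definition primary_sum ::
  "('a::field poly \<Rightarrow> nat list) \<Rightarrow> ('a poly \<times> nat \<Rightarrow> 'a poly) set" where
  "primary_sum lam = {f. finite {i. f i \<noteq> 0} \<and>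
     (\<forall>i\<in>summand_index lam. f i mod summand_modulus lam i = f i) \<and>
     (\<forall>i. i \<notin> summand_index lam \<longrightarrow> f i = 0)}"

definition z_action ::
  "('a::field poly \<Rightarrow> nat list) \<Rightarrow> ('a poly \<times> nat \<Rightarrow> 'a poly) \<Rightarrow> 'a poly \<times> nat \<Rightarrow> 'a poly" where
  "z_action lam f = (\<lambda>i. ([:0, 1:] * f i) mod summand_modulus lam i)"

text \<open>
  A module homomorphism over \<open>F[z]\<close> is an \<open>F\<close>-linear map that commutes with the action of \<open>z\<close>,
  where \<open>z\<close> acts on column vectors as the matrix \<open>A\<close>.
\<close>

definition primary_isomorphism ::
  "'a::field mat \<Rightarrow> ('a poly \<Rightarrow> nat list) \<Rightarrow> ('a Matrix.vec \<Rightarrow> 'a poly \<times> nat \<Rightarrow> 'a poly) \<Rightarrow> bool" where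
  "primary_isomorphism A lam T \<longleftrightarrow>
     (let V = carrier_vec (dim_row A) in
       bij_betw T V (primary_sum lam) \<and>
       (\<forall>v\<in>V. \<forall>w\<in>V. T (v + w) = (\<lambda>i. T v i + T w i)) \<and>
       (\<forall>c. \<forall>v\<in>V. T (c \<cdot>\<^sub>v v) = (\<lambda>i. Polynomial.smult c (T v i))) \<and>
       (\<forall>v\<in>V. T (A *\<^sub>v v) = z_action lam (T v)))"

definition has_primary_partitions :: "'a::field mat \<Rightarrow> ('a poly \<Rightarrow> nat list) \<Rightarrow> bool" where
  "has_primary_partitions A lam \<longleftrightarrow>
     (\<forall>\<phi>\<in>monic_irreducibles. partition_list (lam \<phi>)) \<and> (\<exists>T. primary_isomorphism A lam T)"

text \<open>
  The partitions \<open>lam \<phi>\<close>, for \<open>\<phi>\<close> monic irreducible, exist and are uniquely determined by the square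
  matrix \<open>A\<close> (rational canonical form); the existential quantifier below just names them.
\<close>

definition regular_mat :: "'a::field mat \<Rightarrow> bool" where
  "regular_mat A \<longleftrightarrow>
     (\<exists>lam. has_primary_partitions A lam \<and> (\<forall>\<phi>\<in>monic_irreducibles. length (lam \<phi>) \<le> 1))"

definition semisimple_mat :: "'a::field mat \<Rightarrow> bool" where
  "semisimple_mat A \<longleftrightarrow> (\<exists>D. diagonal_mat D \<and> similar_mat (map_mat to_ac A) D)"

definition regular_semisimple_mat :: "'a::field mat \<Rightarrow> bool" where
  "regular_semisimple_mat A \<longleftrightarrow> regular_mat A \<and> semisimple_mat A"

end

theory Submission
  imports Defs "Jordan_Normal_Form.Char_Poly"
begin

text \<open>
  A matrix is regular-semisimple iff it has a cyclic vector and its characteristic polynomial is a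
  product \<open>\<Prod>S\<close> of distinct monic irreducibles. For monic \<open>f\<close> of degree \<open>n\<close>, the pairs \<open>(A, v)\<close> with
  \<open>v\<close> cyclic for \<open>A\<close> and \<open>f(A) v = 0\<close> correspond to the invertible matrices with columns
  \<open>v, A v, \<dots>, A^(n-1) v\<close>; if \<open>f = \<Prod>S\<close>, each such \<open>A\<close> has as many cyclic vectors as \<open>F[z]/(f)\<close> has
  units, namely \<open>\<Prod>\<phi>\<in>S. q^deg \<phi> - 1\<close>. So the probability is \<open>|GL(n,q)| / q^(n^2)\<close>, which tends to the
  infinite product, times the coefficient of \<open>X^n\<close> in \<open>\<Prod>\<phi>. 1 + X^d / (q^d - 1)\<close> with \<open>d = deg \<phi>\<close>.
  Since \<open>\<Prod>\<phi>. 1 - (X/q)^d = 1 - X\<close>, that coefficient is the \<open>n\<close>-th partial sum of the coefficients of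
  \<open>\<Prod>\<phi>. 1 + (X^d - X^(2d)) / (q^d (q^d - 1))\<close>; all factors are 1 at \<open>X = 1\<close>, and the product converges
  in a disc of radius greater than 1, so the partial sums tend to 1.
\<close>

subsection \<open>Euler products truncated at a finite set of primes\<close>

text \<open>The product over infinitely many irreducibles is never formed: the coefficient of X^n
  sees only irreducibles of degree at most n, so each n needs a finite product of polynomials and an
  error bound uniform in n. That bound comes from evaluating a majorant at X = 6/5. At radius R > 1
  the irreducibles of degree d contribute about q^d * R^(2d) / q^(2d), so R^2 < q is the constraint,
  and 6/5 serves for every q >= 2. The identity for the product of the 1 - (X/q)^d is unique
  factorization combined with the count of q^k monic polynomials of degree k. Semisimplicity is a
  condition over the algebraic closure, while factorization takes place over F; they are tied
  together by the perfectness of finite fields, which makes squarefree polynomials separable.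
  Surjectivity and dimension statements are obtained by comparing cardinalities of finite
  sets.\<close>

lemma coeff_mult_dominated:
  fixes p p' r r' :: "real poly"
  assumes "\<And>i. \<bar>Polynomial.coeff p i\<bar> \<le> Polynomial.coeff p' i"
    and "\<And>i. \<bar>Polynomial.coeff r i\<bar> \<le> Polynomial.coeff r' i"
  shows "\<bar>Polynomial.coeff (p * r) i\<bar> \<le> Polynomial.coeff (p' * r') i"
proof -
  have "\<bar>Polynomial.coeff (p * r) i\<bar> \<le> (\<Sum>k\<le>i. \<bar>Polynomial.coeff p k * Polynomial.coeff r (i - k)\<bar>)"
    unfolding coeff_mult by (rule sum_abs)
  also have "\<dots> \<le> (\<Sum>k\<le>i. Polynomial.coeff p' k * Polynomial.coeff r' (i - k))"
    unfolding abs_mult by (intro sum_mono mult_mono' assms abs_ge_zero)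
  finally show ?thesis by (simp add: coeff_mult)
qed

text \<open>Majorants multiply. This replaces the signed Euler factors by factors with nonnegative
  coefficients, whose product is controlled by its value at a single point.\<close>

lemma coeff_prod_dominated:
  fixes p p' :: "'i \<Rightarrow> real poly"
  assumes "\<And>x i. x \<in> S \<Longrightarrow> \<bar>Polynomial.coeff (p x) i\<bar> \<le> Polynomial.coeff (p' x) i"
  shows "\<bar>Polynomial.coeff (\<Prod>x\<in>S. p x) i\<bar> \<le> Polynomial.coeff (\<Prod>x\<in>S. p' x) i"
  using assms
proof (induction S arbitrary: i rule: infinite_finite_induct)
  case (insert x S)
  then show ?case by (auto intro!: coeff_mult_dominated)
qed (auto simp: coeff_1)

text \<open>The difference is the tail of coefficients beyond n. There \<open>R ^ i / R ^ n\<close>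
  is at least 1, so inserting it only enlarges the majorant, and the enlarged tail is part of G'(R)
  / R^n.\<close>

lemma poly_one_minus_partial_sum_le:
  fixes G G' :: "real poly"
  assumes dom: "\<And>i. \<bar>Polynomial.coeff G i\<bar> \<le> Polynomial.coeff G' i" and R: "R \<ge> 1"
  shows "\<bar>poly G 1 - (\<Sum>i\<le>n. Polynomial.coeff G i)\<bar> \<le> poly G' R / R ^ n"
proof -
  define N where "N = Max {n, Polynomial.degree G, Polynomial.degree G'}"
  have N: "n \<le> N" "Polynomial.degree G \<le> N" "Polynomial.degree G' \<le> N" by (auto simp: N_def)
  have nonneg: "Polynomial.coeff G' i \<ge> 0" for i using dom[of i] by linarith
  have "poly G 1 = (\<Sum>i\<le>N. Polynomial.coeff G i)"
    unfolding poly_altdef using N by (auto intro!: sum.mono_neutral_left coeff_eq_0)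
  also have "{..N} = {..n} \<union> {n<..N}" using N by auto
  also have "(\<Sum>i\<in>{..n} \<union> {n<..N}. Polynomial.coeff G i) = (\<Sum>i\<le>n. Polynomial.coeff G i) + (\<Sum>i\<in>{n<..N}. Polynomial.coeff G i)"
    by (intro sum.union_disjoint) auto
  finally have "\<bar>poly G 1 - (\<Sum>i\<le>n. Polynomial.coeff G i)\<bar> = \<bar>\<Sum>i\<in>{n<..N}. Polynomial.coeff G i\<bar>" by simp
  also have "\<dots> \<le> (\<Sum>i\<in>{n<..N}. \<bar>Polynomial.coeff G i\<bar>)" by (rule sum_abs)
  also have "\<dots> \<le> (\<Sum>i\<in>{n<..N}. Polynomial.coeff G' i * R ^ i / R ^ n)"
  proof (rule sum_mono)
    fix i assume "i \<in> {n<..N}"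
    then have "R ^ n \<le> R ^ i" using R by (auto intro!: power_increasing)
    then have "1 \<le> R ^ i / R ^ n" using R by (simp add: field_simps)
    then have "Polynomial.coeff G' i * 1 \<le> Polynomial.coeff G' i * (R ^ i / R ^ n)"
      using nonneg by (intro mult_left_mono)
    then show "\<bar>Polynomial.coeff G i\<bar> \<le> Polynomial.coeff G' i * R ^ i / R ^ n" using dom[of i] by simp
  qed
  also have "\<dots> \<le> (\<Sum>i\<le>N. Polynomial.coeff G' i * R ^ i / R ^ n)"
    using nonneg R by (intro sum_mono2) auto
  also have "\<dots> = (\<Sum>i\<le>N. Polynomial.coeff G' i * R ^ i) / R ^ n" by (simp add: sum_divide_distrib)
  also have "(\<Sum>i\<le>N. Polynomial.coeff G' i * R ^ i) = poly G' R"
    unfolding poly_altdef using N by (auto intro!: sum.mono_neutral_right coeff_eq_0)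
  finally show ?thesis .
qed

text \<open>With t = Q^d the coefficient at X^d is 1/(t-1) - 1/t = 1/(t(t-1)), and the one at X^(2d)
  is its negative. Both are of order 1/t^2 instead of 1/t; this gain outweighs the roughly t
  irreducibles of degree d and gives convergence beyond radius 1.\<close>

lemma euler_factor_mult:
  fixes Q :: real
  assumes "Q > 1" "d > 0"
  shows "(1 + Polynomial.monom (1 / (Q ^ d - 1)) d) * (1 - Polynomial.monom (1 / Q ^ d) d)
     = 1 + Polynomial.monom (1 / (Q ^ d * (Q ^ d - 1))) d - Polynomial.monom (1 / (Q ^ d * (Q ^ d - 1))) (2 * d)"
proof -
  have "1 / (t - 1) - 1 / t = 1 / (t * (t - 1))" if "t > 1" for t :: real
    using that by (simp add: field_simps)
  then have "1 / (Q ^ d - 1) - 1 / Q ^ d = 1 / (Q ^ d * (Q ^ d - 1))"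
    using assms one_less_power by blast
  then have "Polynomial.monom (1 / (Q ^ d - 1)) d - Polynomial.monom (1 / Q ^ d) d = Polynomial.monom (1 / (Q ^ d * (Q ^ d - 1))) d"
    by (simp only: diff_monom)
  moreover have "Polynomial.monom (1 / (Q ^ d - 1)) d * Polynomial.monom (1 / Q ^ d) d
     = Polynomial.monom (1 / (Q ^ d * (Q ^ d - 1))) (2 * d)"
    unfolding mult_monom mult_2 by (simp add: mult.commute)
  ultimately show ?thesis by (simp add: algebra_simps)
qed

text \<open>By 1 + x \<le> exp x it suffices to bound a sum, grouped by degree. Of the two powers
  Q^k in the denominator, one cancels the number of elements of degree k; the other is at least 2^k
  and turns (6/5)^(2k) into (18/25)^k. The resulting geometric series does not depend on P.\<close>

lemma prod_euler_factors_bounded: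
  fixes Q :: real and d :: "'i \<Rightarrow> nat"
  assumes Q: "Q \<ge> 2" and P: "finite P" "\<And>x. x \<in> P \<Longrightarrow> d x > 0"
    and card: "\<And>k. real (card {x \<in> P. d x = k}) \<le> Q ^ k"
  shows "(\<Prod>x\<in>P. 1 + 1 / (Q ^ d x * (Q ^ d x - 1)) * ((6/5) ^ d x + (6/5) ^ (2 * d x))) \<le> exp 16"
proof -
  let ?t = "\<lambda>k. 1 / (Q ^ k * (Q ^ k - 1)) * ((6/5) ^ k + (6/5) ^ (2 * k))"
  have Qk: "Q ^ k \<ge> 2" if "k > 0" for k
    using Q power_increasing[of 1 k Q] that by simp
  have t: "?t k \<le> 4 * (18/25) ^ k / Q ^ k" if "k > 0" for k
  proof -
    have 1: "Q ^ k - 1 \<ge> Q ^ k / 2" using Qk[OF that] by simp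
    have "(6/5::real) ^ k \<le> (6/5) ^ (2 * k)" by (intro power_increasing) auto
    then have 2: "(6/5) ^ k + (6/5) ^ (2 * k) \<le> 2 * (36/25::real) ^ k"
      by (simp add: power_mult power2_eq_square)
    have "?t k \<le> 1 / (Q ^ k * (Q ^ k / 2)) * (2 * (36/25) ^ k)"
      using 1 2 Qk[OF that] by (intro mult_mono divide_left_mono) auto
    also have "\<dots> = 4 * ((36/25) ^ k / Q ^ k) / Q ^ k" by (simp add: field_simps)
    also have "\<dots> \<le> 4 * ((36/25) ^ k / 2 ^ k) / Q ^ k"
      using Q by (intro divide_right_mono mult_left_mono divide_left_mono power_mono) auto
    also have "(36/25) ^ k / 2 ^ k = (18/25::real) ^ k" by (simp flip: power_divide)
    finally show ?thesis .
  qed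
  define N where "N = Max (insert 0 (d ` P))"
  have dN: "d x \<le> N" if "x \<in> P" for x using that P by (auto simp: N_def)
  have t0: "?t k \<ge> 0" if "k > 0" for k using Qk[OF that] Q by auto
  have "(\<Prod>x\<in>P. 1 + ?t (d x)) \<le> exp (\<Sum>x\<in>P. ?t (d x))"
    by (rule prod_le_exp_sum) (use t0 P in auto)
  also have "(\<Sum>x\<in>P. ?t (d x)) \<le> (\<Sum>x\<in>P. 4 * (18/25) ^ d x / Q ^ d x)"
    by (intro sum_mono t P)
  also have "\<dots> = (\<Sum>k\<in>{1..N}. \<Sum>x\<in>{x\<in>P. d x = k}. 4 * (18/25) ^ d x / Q ^ d x)"
    by (rule sum.group[symmetric]) (use P dN in \<open>auto simp: Suc_le_eq\<close>)
  also have "\<dots> = (\<Sum>k\<in>{1..N}. real (card {x \<in> P. d x = k}) * (4 * (18/25) ^ k / Q ^ k))"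
    by simp
  also have "\<dots> \<le> (\<Sum>k\<in>{1..N}. Q ^ k * (4 * (18/25) ^ k / Q ^ k))"
    using Q by (intro sum_mono mult_right_mono card) auto
  also have "\<dots> = 4 * (\<Sum>k\<in>{1..N}. (18/25) ^ k)"
    using Q by (simp add: sum_distrib_left)
  also have "(\<Sum>k\<in>{1..N}. (18/25::real) ^ k) \<le> (\<Sum>k<Suc N. (18/25) ^ k)"
    by (intro sum_mono2) auto
  also have "(\<Sum>k<Suc N. (18/25::real) ^ k) = (1 - (18/25) ^ Suc N) * (25 / 7)"
    by (subst sum_gp_strict) (simp add: field_simps)
  \<comment> \<open>The geometric series has sum 1 / (1 - 18/25) = 25/7, rounded up to 4; with the
    factor 4 in front this gives the exponent 16.\<close>
  also have "\<dots> \<le> 1 * 4" by (intro mult_mono) auto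
  finally show ?thesis by simp
qed

text \<open>
  The hypothesis on \<open>A\<close> says that \<open>\<Prod>x. 1 - (X/Q)^d x\<close> agrees with \<open>1 - X\<close> up to degree \<open>n\<close>,
  as it does for the zeta function of the polynomial ring.
\<close>

lemma squarefree_coeff_bound:
  fixes Q :: real and d :: "'i \<Rightarrow> nat" and A :: "real fps"
  assumes Q: "Q \<ge> 2" and P: "finite P" "\<And>x. x \<in> P \<Longrightarrow> d x > 0"
    and card: "\<And>k. real (card {x \<in> P. d x = k}) \<le> Q ^ k"
    and A: "A * fps_of_poly (\<Prod>x\<in>P. 1 - Polynomial.monom (1 / Q ^ d x) (d x)) = 1"
    and A1: "\<And>k. k \<le> n \<Longrightarrow> fps_nth A k = 1"
  shows "\<bar>Polynomial.coeff (\<Prod>x\<in>P. 1 + Polynomial.monom (1 / (Q ^ d x - 1)) (d x)) n - 1\<bar> \<le> exp 16 / (6/5) ^ n"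
proof -
  define c where "c = (\<lambda>x. 1 / (Q ^ d x * (Q ^ d x - 1)))"
  define B where "B = (\<Prod>x\<in>P. 1 + Polynomial.monom (1 / (Q ^ d x - 1)) (d x))"
  define Z where "Z = (\<Prod>x\<in>P. 1 - Polynomial.monom (1 / Q ^ d x) (d x))"
  define G where "G = (\<Prod>x\<in>P. 1 + Polynomial.monom (c x) (d x) - Polynomial.monom (c x) (2 * d x))"
  define G' where "G' = (\<Prod>x\<in>P. 1 + Polynomial.monom (c x) (d x) + Polynomial.monom (c x) (2 * d x))"
  have c0: "c x \<ge> 0" if "x \<in> P" for x
    unfolding c_def using Q one_le_power[of Q "d x"] by simp
  have G: "G = B * Z"
    unfolding G_def B_def Z_def c_def prod.distrib[symmetric]
    by (intro prod.cong refl euler_factor_mult[symmetric]) (use Q P in auto)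
  \<comment> \<open>\<open>A\<close> is the inverse of Z, so B = A * G. Up to X^n the series
    \<open>A\<close> agrees with 1/(1 - X), and multiplying by the latter sums coefficients.\<close>
  have "fps_of_poly B = A * fps_of_poly Z * fps_of_poly B" using A by (simp add: Z_def)
  also have "\<dots> = A * fps_of_poly G" by (simp add: G fps_of_poly_mult mult_ac)
  finally have "Polynomial.coeff B n = (\<Sum>i\<le>n. Polynomial.coeff G i * fps_nth A (n - i))"
    by (metis (no_types, lifting) fps_of_poly_nth fps_mult_nth mult.commute sum.cong atLeast0AtMost)
  also have "\<dots> = (\<Sum>i\<le>n. Polynomial.coeff G i)" by (simp add: A1)
  finally have B: "Polynomial.coeff B n = (\<Sum>i\<le>n. Polynomial.coeff G i)" .
  have "\<bar>Polynomial.coeff G i\<bar> \<le> Polynomial.coeff G' i" for i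
    unfolding G_def G'_def by (rule coeff_prod_dominated) (use c0 in \<open>auto simp: coeff_1 abs_if\<close>)
  then have "\<bar>poly G 1 - (\<Sum>i\<le>n. Polynomial.coeff G i)\<bar> \<le> poly G' (6/5) / (6/5) ^ n"
    by (rule poly_one_minus_partial_sum_le) simp
  also have "poly G 1 = 1" by (simp add: G_def poly_prod poly_monom)
  also have "poly G' (6/5) \<le> exp 16"
    using prod_euler_factors_bounded[OF Q P card]
    by (simp add: G'_def poly_prod poly_monom c_def algebra_simps add_divide_distrib)
  finally show ?thesis unfolding B_def[symmetric] B
    by (simp add: abs_minus_commute divide_right_mono)
qed

subsection \<open>Polynomials and products of monic irreducibles\<close>

text \<open>Canonical representatives modulo a polynomial of degree n. The condition is on
  coefficients because \<open>degree 0 = 0\<close>: the bound \<open>degree p < n\<close> alone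
  would lose the zero polynomial at n = 0.\<close>

definition polys_below :: "nat \<Rightarrow> 'a::zero poly set" where
  "polys_below n = {p. \<forall>i\<ge>n. Polynomial.coeff p i = 0}"

lemma polys_below_iff_degree: "p \<in> polys_below n \<longleftrightarrow> p = 0 \<or> Polynomial.degree p < n"
proof
  assume "p = 0 \<or> Polynomial.degree p < n"
  then show "p \<in> polys_below n" by (auto simp: polys_below_def intro: coeff_eq_0)
next
  assume "p \<in> polys_below n"
  then show "p = 0 \<or> Polynomial.degree p < n"
    unfolding polys_below_def by (cases "Polynomial.degree p < n") (auto simp flip: leading_coeff_0_iff)
qed

lemma mod_eq_self_iff_polys_below:
  fixes f :: "'a::field poly"
  assumes "f \<noteq> 0"
  shows "p mod f = p \<longleftrightarrow> p \<in> polys_below (Polynomial.degree f)"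
  by (metis assms degree_mod_less mod_0 mod_poly_less polys_below_iff_degree)

lemma mod_in_polys_below:
  fixes f :: "'a::field poly"
  shows "f \<noteq> 0 \<Longrightarrow> p mod f \<in> polys_below (Polynomial.degree f)"
  by (metis mod_eq_self_iff_polys_below mod_mod_trivial)

lemma polys_below_diff: "p \<in> polys_below n \<Longrightarrow> r \<in> polys_below n \<Longrightarrow> p - r \<in> polys_below n"
  for p :: "'a::ab_group_add poly"
  by (auto simp: polys_below_def)

lemma bij_betw_coeffs_polys_below:
  "bij_betw (\<lambda>p. restrict (Polynomial.coeff p) {..<n}) (polys_below n) (PiE {..<n} (\<lambda>_. UNIV))"
proof (rule bij_betw_byWitness[where f' = "\<lambda>g. Poly (map g [0..<n])"])
  show "\<forall>p\<in>polys_below n. Poly (map (restrict (Polynomial.coeff p) {..<n}) [0..<n]) = p"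
    by (auto intro!: poly_eqI simp: polys_below_def nth_default_def)
  show "\<forall>g\<in>PiE {..<n} (\<lambda>_. UNIV). restrict (Polynomial.coeff (Poly (map g [0..<n]))) {..<n} = g"
    by (auto intro!: ext simp: nth_default_def restrict_def PiE_def extensional_def)
  show "(\<lambda>p. restrict (Polynomial.coeff p) {..<n}) ` polys_below n \<subseteq> PiE {..<n} (\<lambda>_. UNIV)"
    by (simp add: image_subset_iff restrict_PiE_iff)
  show "(\<lambda>g. Poly (map g [0..<n])) ` PiE {..<n} (\<lambda>_. UNIV) \<subseteq> polys_below n"
    by (simp add: polys_below_def image_subset_iff nth_default_beyond)
qed

lemma card_polys_below: "card (polys_below n :: 'a::{zero,finite} poly set) = CARD('a) ^ n"
  using bij_betw_same_card[OF bij_betw_coeffs_polys_below[where 'a='a, of n]] by (simp add: card_PiE)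

lemma finite_polys_below: "finite (polys_below n :: 'a::{zero,finite} poly set)"
  using bij_betw_finite[OF bij_betw_coeffs_polys_below[where 'a='a, of n]] by (simp add: finite_PiE)

lemma monic_irreduciblesD:
  fixes \<phi> :: "'a::field poly"
  assumes "\<phi> \<in> monic_irreducibles"
  shows "Polynomial.lead_coeff \<phi> = 1" "\<phi> \<noteq> 0" "Polynomial.degree \<phi> > 0" "prime_elem \<phi>"
proof -
  have irr: "Factorial_Ring.irreducible \<phi>" and m: "Polynomial.lead_coeff \<phi> = 1"
    using assms by (auto simp: monic_irreducibles_def)
  show "Polynomial.lead_coeff \<phi> = 1" "\<phi> \<noteq> 0" using m by auto
  show "prime_elem \<phi>" using irr by (rule field_poly_irreducible_imp_prime)
  show "Polynomial.degree \<phi> > 0"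
    using irr \<open>\<phi> \<noteq> 0\<close> unfolding Factorial_Ring.irreducible_def by (auto simp: is_unit_iff_degree)
qed

lemma monic_dvd_same_degree_eq:
  fixes p r :: "'a::field poly"
  assumes "p dvd r" "Polynomial.degree p = Polynomial.degree r"
    "Polynomial.lead_coeff p = 1" "Polynomial.lead_coeff r = 1"
  shows "p = r"
proof -
  obtain k where k: "r = p * k" using assms(1) by (elim dvdE)
  then have "k \<noteq> 0" "p \<noteq> 0" using assms by auto
  then have "Polynomial.degree k = 0" using k assms(2) by (simp add: degree_mult_eq)
  then obtain c where c: "k = [:c:]" by (elim degree_eq_zeroE)
  have "c = 1" using k c assms by (simp add: lead_coeff_mult)
  then show ?thesis using k c by simp
qed

lemma monic_irreducibles_dvd_imp_eq:
  fixes \<phi> \<psi> :: "'a::field poly"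
  assumes "\<phi> \<in> monic_irreducibles" "\<psi> \<in> monic_irreducibles" "\<phi> dvd \<psi>"
  shows "\<phi> = \<psi>"
proof -
  note p = monic_irreduciblesD[OF assms(1)] and s = monic_irreduciblesD[OF assms(2)]
  obtain k where k: "\<psi> = \<phi> * k" using assms(3) by (elim dvdE)
  have "Factorial_Ring.irreducible \<psi>" using assms(2) by (simp add: monic_irreducibles_def)
  then have "\<phi> dvd 1 \<or> k dvd 1" using k by (rule Factorial_Ring.irreducibleD)
  then have "k dvd 1" using p(4) by (auto simp: prime_elem_def)
  then have "k \<noteq> 0" "Polynomial.degree k = 0" using is_unit_iff_degree[of k] k s by auto
  then have "Polynomial.degree \<phi> = Polynomial.degree \<psi>" using k p by (simp add: degree_mult_eq)
  then show ?thesis using monic_dvd_same_degree_eq assms(3) p(1) s(1) by blast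
qed

lemma exists_monic_irreducible_dvd:
  fixes p :: "'a::field poly"
  assumes "Polynomial.degree p > 0"
  shows "\<exists>\<phi>\<in>monic_irreducibles. \<phi> dvd p"
  using assms
proof (induction "Polynomial.degree p" arbitrary: p rule: less_induct)
  case less
  have p0: "p \<noteq> 0" using less.prems by auto
  show ?case
  proof (cases "Factorial_Ring.irreducible p")
    case True
    define r where "r = Polynomial.smult (inverse (Polynomial.lead_coeff p)) p"
    have "Factorial_Ring.irreducible r"
      using True p0 irreducible_mult_unit_left[of "[:inverse (Polynomial.lead_coeff p):]" p]
      by (simp add: r_def is_unit_iff_degree)
    moreover have "Polynomial.lead_coeff r = 1" using p0 by (simp add: r_def)
    moreover have "r dvd p" unfolding r_def using p0 by (simp add: smult_dvd_iff)
    ultimately show ?thesis unfolding monic_irreducibles_def by blast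
  next
    case False
    have "\<not> p dvd 1" using less.prems p0 by (simp add: is_unit_iff_degree)
    with False p0 obtain a b where ab: "p = a * b" "\<not> a dvd 1" "\<not> b dvd 1"
      unfolding Factorial_Ring.irreducible_def by blast
    have nz: "a \<noteq> 0" "b \<noteq> 0" using ab p0 by auto
    then have "Polynomial.degree a > 0" "Polynomial.degree b > 0"
      using ab(2,3) is_unit_iff_degree[of a] is_unit_iff_degree[of b] by auto
    moreover have "Polynomial.degree p = Polynomial.degree a + Polynomial.degree b"
      using ab nz by (simp add: degree_mult_eq)
    ultimately obtain \<phi> where "\<phi> \<in> monic_irreducibles" "\<phi> dvd a" using less.hyps[of a] by auto
    then show ?thesis unfolding ab(1) by (meson dvd_mult2)
  qed
qed

lemma dvd_prod_monic_irreducibles_iff: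
  fixes S :: "'a::field poly set"
  assumes "finite S" "S \<subseteq> monic_irreducibles" "\<phi> \<in> monic_irreducibles"
  shows "\<phi> dvd \<Prod>S \<longleftrightarrow> \<phi> \<in> S"
proof
  have prime: "prime_elem \<phi>" using assms(3) by (rule monic_irreduciblesD)
  assume "\<phi> dvd \<Prod>S"
  with assms(1) have "\<exists>\<psi>\<in>S. \<phi> dvd \<psi>"
  proof (induction S rule: finite_induct)
    case empty
    then show ?case using prime unfolding prime_elem_def prod.empty by blast
  next
    case (insert \<psi> S)
    then have "\<phi> dvd \<psi> \<or> \<phi> dvd \<Prod>S" using prime by (simp add: prime_elem_dvd_mult_iff)
    then show ?case using insert.IH by blast
  qed
  then obtain \<psi> where "\<psi> \<in> S" "\<phi> dvd \<psi>" by blast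
  then show "\<phi> \<in> S" using monic_irreducibles_dvd_imp_eq assms by blast
qed (auto intro: dvd_prod_eqI assms)

lemma prod_monic_irreducibles_dvd:
  fixes S :: "'a::field poly set"
  assumes "finite S" "S \<subseteq> monic_irreducibles" "\<And>\<phi>. \<phi> \<in> S \<Longrightarrow> \<phi> dvd p"
  shows "\<Prod>S dvd p"
  using assms
proof (induction S)
  case (insert \<phi> S)
  then have "\<Prod>S dvd p" by simp
  then obtain k where k: "p = \<Prod>S * k" by (elim dvdE)
  have "prime_elem \<phi>" using insert.prems by (auto intro: monic_irreduciblesD)
  moreover have "\<not> \<phi> dvd \<Prod>S" using insert by (subst dvd_prod_monic_irreducibles_iff) auto
  ultimately have "\<phi> dvd k" using insert.prems(2)[of \<phi>] k by (simp add: prime_elem_dvd_mult_iff)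
  then show ?case using insert k by (simp add: mult.commute mult_dvd_mono)
qed auto

lemma lead_coeff_prod_monic_irreducibles:
  fixes S :: "'a::field poly set"
  assumes "S \<subseteq> monic_irreducibles"
  shows "Polynomial.lead_coeff (\<Prod>S) = 1"
  unfolding lead_coeff_prod by (rule prod.neutral) (use assms monic_irreduciblesD(1) in auto)

lemma degree_prod_monic_irreducibles:
  fixes S :: "'a::field poly set"
  assumes "S \<subseteq> monic_irreducibles"
  shows "Polynomial.degree (\<Prod>S) = sum Polynomial.degree S"
  by (rule degree_prod_eq_sum_degree) (use assms monic_irreduciblesD(2) in auto)

text \<open>Chinese remainder theorem. Two polynomials with equal residues differ by a multiple of
  \<open>\<Prod>S\<close>, which is 0 by degree; surjectivity follows because both sides have the
  same finite cardinality.\<close>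

lemma bij_betw_residues:
  fixes S :: "'a::{field,finite} poly set"
  assumes "finite S" "S \<subseteq> monic_irreducibles"
  shows "bij_betw (\<lambda>g. \<lambda>\<phi>\<in>S. g mod \<phi>) (polys_below (sum Polynomial.degree S))
    (PiE S (\<lambda>\<phi>. polys_below (Polynomial.degree \<phi>)))"
proof -
  let ?L = "polys_below (sum Polynomial.degree S) :: 'a poly set"
  let ?h = "\<lambda>g::'a poly. \<lambda>\<phi>\<in>S. g mod \<phi>"
  let ?E = "PiE S (\<lambda>\<phi>. polys_below (Polynomial.degree \<phi>)) :: ('a poly \<Rightarrow> 'a poly) set"
  have inj: "inj_on ?h ?L"
  proof (rule inj_onI)
    fix g h assume g: "g \<in> ?L" "h \<in> ?L" and eq: "?h g = ?h h"
    have "\<phi> dvd g - h" if "\<phi> \<in> S" for \<phi>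
      using fun_cong[OF eq, of \<phi>] that by (simp add: mod_eq_dvd_iff)
    then have "\<Prod>S dvd g - h" using prod_monic_irreducibles_dvd assms by blast
    moreover have "g - h = 0 \<or> Polynomial.degree (g - h) < Polynomial.degree (\<Prod>S)"
      using polys_below_diff[OF g] degree_prod_monic_irreducibles[OF assms(2)] by (simp add: polys_below_iff_degree)
    ultimately have "g - h = 0" using dvd_imp_degree_le linorder_not_less by blast
    then show "g = h" by simp
  qed
  have sub: "?h ` ?L \<subseteq> ?E"
  proof (intro image_subsetI restrict_PiE_iff[THEN iffD2] ballI)
    show "g mod \<phi> \<in> polys_below (Polynomial.degree \<phi>)" if "\<phi> \<in> S" for g \<phi> :: "'a poly"
      using that assms monic_irreduciblesD(2) by (intro mod_in_polys_below) auto
  qed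
  have fin: "finite ?E" by (intro finite_PiE assms finite_polys_below)
  have "card ?E = card ?L"
    using assms by (simp add: card_PiE card_polys_below power_sum)
  then have "?h ` ?L = ?E" using sub fin inj by (metis card_image card_subset_eq)
  then show ?thesis using inj by (simp add: bij_betw_def)
qed

text \<open>Under the Chinese remainder bijection, being prime to every member of S means that no
  residue is 0, and each field F[z]/(\<phi>) has q^deg \<phi> - 1 nonzero elements.\<close>

lemma card_units_mod_prod:
  fixes S :: "'a::{field,finite} poly set"
  assumes "finite S" "S \<subseteq> monic_irreducibles"
  shows "card {g \<in> polys_below (sum Polynomial.degree S). \<forall>\<phi>\<in>S. \<not> \<phi> dvd g}
    = (\<Prod>\<phi>\<in>S. CARD('a) ^ Polynomial.degree \<phi> - 1)"
proof -
  let ?L = "polys_below (sum Polynomial.degree S) :: 'a poly set"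
  let ?h = "\<lambda>g::'a poly. \<lambda>\<phi>\<in>S. g mod \<phi>"
  let ?E = "PiE S (\<lambda>\<phi>. polys_below (Polynomial.degree \<phi>)) :: ('a poly \<Rightarrow> 'a poly) set"
  let ?E' = "PiE S (\<lambda>\<phi>. polys_below (Polynomial.degree \<phi>) - {0}) :: ('a poly \<Rightarrow> 'a poly) set"
  note bij = bij_betw_residues[OF assms]
  have "?h ` {g \<in> ?L. \<forall>\<phi>\<in>S. \<not> \<phi> dvd g} = ?E'"
  proof (intro equalityI subsetI)
    fix u assume "u \<in> ?h ` {g \<in> ?L. \<forall>\<phi>\<in>S. \<not> \<phi> dvd g}"
    then obtain g where g: "g \<in> ?L" "\<forall>\<phi>\<in>S. \<not> \<phi> dvd g" "u = ?h g" by (elim imageE CollectE conjE) simp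
    then have "u \<in> ?E" using bij_betwE[OF bij] by simp
    with g show "u \<in> ?E'" by (auto simp: PiE_iff dvd_eq_mod_eq_0)
  next
    fix u assume u: "u \<in> ?E'"
    then have "u \<in> ?E" by (auto simp: PiE_iff)
    then obtain g where g: "g \<in> ?L" "u = ?h g"
      unfolding bij_betw_imp_surj_on[OF bij, symmetric] by (elim imageE)
    with u show "u \<in> ?h ` {g \<in> ?L. \<forall>\<phi>\<in>S. \<not> \<phi> dvd g}"
      by (auto simp: PiE_iff dvd_eq_mod_eq_0 intro!: image_eqI[of _ _ g])
  qed
  then have "card {g \<in> ?L. \<forall>\<phi>\<in>S. \<not> \<phi> dvd g} = card ?E'"
    using card_image[OF inj_on_subset[OF bij_betw_imp_inj_on[OF bij], of "{g \<in> ?L. \<forall>\<phi>\<in>S. \<not> \<phi> dvd g}"]]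
    by simp
  also have "\<dots> = (\<Prod>\<phi>\<in>S. CARD('a) ^ Polynomial.degree \<phi> - 1)"
    using assms by (auto simp: card_PiE card_Diff_singleton card_polys_below polys_below_iff_degree intro!: prod.cong)
  finally show ?thesis .
qed

subsection \<open>Counting monic polynomials\<close>

text \<open>The counts of these sets are the coefficients of the zeta function of F[z] truncated to
  the primes in P. Stating the condition by divisibility avoids carrying factorizations as
  multisets.\<close>

definition monic_with_factors_in :: "'a::field poly set \<Rightarrow> nat \<Rightarrow> 'a poly set" where
  "monic_with_factors_in P k = {f. Polynomial.lead_coeff f = 1 \<and> Polynomial.degree f = k \<and>
     (\<forall>\<phi>\<in>monic_irreducibles. \<phi> dvd f \<longrightarrow> \<phi> \<in> P)}"

lemma bij_betw_monic_polys_below: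
  "bij_betw (\<lambda>p. p + Polynomial.monom 1 k) (polys_below k)
     {f :: 'a::comm_ring_1 poly. Polynomial.lead_coeff f = 1 \<and> Polynomial.degree f = k}"
proof (rule bij_betw_byWitness[where f' = "\<lambda>p. p - Polynomial.monom 1 k"])
  show "(\<lambda>p. p + Polynomial.monom 1 k) ` polys_below k
    \<subseteq> {f :: 'a poly. Polynomial.lead_coeff f = 1 \<and> Polynomial.degree f = k}"
  proof (rule image_subsetI)
    fix p :: "'a poly" assume p: "p \<in> polys_below k"
    have "Polynomial.degree (p + Polynomial.monom 1 k) = k"
    proof (rule antisym)
      show "Polynomial.degree (p + Polynomial.monom 1 k) \<le> k"
        using p by (intro degree_le) (auto simp: polys_below_def)
      show "k \<le> Polynomial.degree (p + Polynomial.monom 1 k)"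
        using p by (intro le_degree) (auto simp: polys_below_def)
    qed
    then show "p + Polynomial.monom 1 k \<in> {f. Polynomial.lead_coeff f = 1 \<and> Polynomial.degree f = k}"
      using p by (simp add: polys_below_def)
  qed
  show "(\<lambda>p. p - Polynomial.monom 1 k) `
      {f :: 'a poly. Polynomial.lead_coeff f = 1 \<and> Polynomial.degree f = k} \<subseteq> polys_below k"
    by (auto simp: polys_below_def coeff_eq_0)
qed auto

lemma card_monic:
  "card {f :: 'a::{comm_ring_1,finite} poly. Polynomial.lead_coeff f = 1 \<and> Polynomial.degree f = k} = CARD('a) ^ k"
  using bij_betw_same_card[OF bij_betw_monic_polys_below[where 'a='a, of k]] by (simp add: card_polys_below)

lemma finite_monic:
  "finite {f :: 'a::{comm_ring_1,finite} poly. Polynomial.lead_coeff f = 1 \<and> Polynomial.degree f = k}"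
  using bij_betw_finite[OF bij_betw_monic_polys_below[where 'a='a, of k]] by (simp add: finite_polys_below)

lemma finite_monic_with_factors_in: "finite (monic_with_factors_in P k :: 'a::{field,finite} poly set)"
  by (rule finite_subset[OF _ finite_monic[of k]]) (auto simp: monic_with_factors_in_def)

lemma monic_with_factors_in_empty:
  "monic_with_factors_in {} k = (if k = 0 then {1 :: 'a::field poly} else {})"
proof -
  have "f \<in> monic_with_factors_in {} k \<longleftrightarrow> k = 0 \<and> f = 1" for f :: "'a poly"
  proof
    assume f: "f \<in> monic_with_factors_in {} k"
    then have "Polynomial.degree f = 0"
      using exists_monic_irreducible_dvd[of f] by (auto simp: monic_with_factors_in_def)
    then show "k = 0 \<and> f = 1" using f by (auto simp: monic_with_factors_in_def elim!: degree_eq_zeroE)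
  next
    assume "k = 0 \<and> f = 1"
    moreover have "\<not> \<phi> dvd 1" if "\<phi> \<in> monic_irreducibles" for \<phi> :: "'a poly"
      using monic_irreduciblesD(4)[OF that] unfolding prime_elem_def by blast
    ultimately show "f \<in> monic_with_factors_in {} k" by (auto simp: monic_with_factors_in_def)
  qed
  then show ?thesis by auto
qed

text \<open>Either \<phi> does not divide f, or f = \<phi> g where g may again contain \<phi>. For
  generating functions this says that multiplying the series of \<open>insert \<phi> P\<close> by 1
  - X^d, with d = deg \<phi>, gives the series of P.\<close>

lemma card_monic_with_factors_in_insert:
  fixes P :: "'a::{field,finite} poly set"
  assumes \<phi>: "\<phi> \<in> monic_irreducibles" "\<phi> \<notin> P"
  shows "card (monic_with_factors_in (insert \<phi> P) k) = card (monic_with_factors_in P k) +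
    (if Polynomial.degree \<phi> \<le> k then card (monic_with_factors_in (insert \<phi> P) (k - Polynomial.degree \<phi>)) else 0)"
proof -
  let ?M = "monic_with_factors_in (insert \<phi> P)" and ?d = "Polynomial.degree \<phi>"
  note \<phi>' = monic_irreduciblesD[OF \<phi>(1)]
  have split: "?M k = monic_with_factors_in P k \<union> {f \<in> ?M k. \<phi> dvd f}"
    using \<phi> by (auto simp: monic_with_factors_in_def)
  have disj: "monic_with_factors_in P k \<inter> {f \<in> ?M k. \<phi> dvd f} = {}"
    using \<phi> by (auto simp: monic_with_factors_in_def)
  have "{f \<in> ?M k. \<phi> dvd f} = (if ?d \<le> k then (\<lambda>g. \<phi> * g) ` ?M (k - ?d) else {})"
  proof (intro equalityI subsetI)
    fix f assume f: "f \<in> {f \<in> ?M k. \<phi> dvd f}"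
    then obtain g where g: "f = \<phi> * g" unfolding dvd_def by blast
    have f': "Polynomial.lead_coeff f = 1" "Polynomial.degree f = k" using f by (auto simp: monic_with_factors_in_def)
    then have "f \<noteq> 0" by auto
    then have g0: "g \<noteq> 0" using g by auto
    have deg: "?d + Polynomial.degree g = k" using f'(2) g g0 \<phi>' by (simp add: degree_mult_eq)
    have "Polynomial.lead_coeff g = 1" using f'(1) g \<phi>' by (simp add: lead_coeff_mult)
    then have "g \<in> ?M (k - ?d)"
      using f g deg by (auto simp: monic_with_factors_in_def)
    then show "f \<in> (if ?d \<le> k then (\<lambda>g. \<phi> * g) ` ?M (k - ?d) else {})" using g deg by auto
  next
    fix f assume "f \<in> (if ?d \<le> k then (\<lambda>g. \<phi> * g) ` ?M (k - ?d) else {})"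
    then obtain g where g: "?d \<le> k" "f = \<phi> * g" "g \<in> ?M (k - ?d)" by (auto split: if_splits)
    have g': "Polynomial.lead_coeff g = 1" "Polynomial.degree g = k - ?d" using g by (auto simp: monic_with_factors_in_def)
    then have "g \<noteq> 0" by auto
    then have "Polynomial.degree f = k" using g g' \<phi>' by (simp add: degree_mult_eq)
    moreover have "Polynomial.lead_coeff f = 1" by (simp only: g(2) lead_coeff_mult g'(1) \<phi>'(1) mult_1)
    moreover have "\<psi> \<in> insert \<phi> P" if "\<psi> \<in> monic_irreducibles" "\<psi> dvd f" for \<psi>
    proof -
      have "\<psi> dvd \<phi> \<or> \<psi> dvd g"
        using that(2) monic_irreduciblesD(4)[OF that(1)] by (simp add: g prime_elem_dvd_mult_iff)
      then show ?thesis
        using that monic_irreducibles_dvd_imp_eq[OF that(1) \<phi>(1)] g(3) by (auto simp: monic_with_factors_in_def)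
    qed
    ultimately show "f \<in> {f \<in> ?M k. \<phi> dvd f}" using g by (simp add: monic_with_factors_in_def)
  qed
  moreover have "card ((\<lambda>g. \<phi> * g) ` ?M (k - ?d)) = card (?M (k - ?d))"
    using \<phi>' by (intro card_image inj_onI) simp
  ultimately have "card {f \<in> ?M k. \<phi> dvd f} = (if ?d \<le> k then card (?M (k - ?d)) else 0)" by simp
  moreover have "card (?M k) = card (monic_with_factors_in P k) + card {f \<in> ?M k. \<phi> dvd f}"
    by (subst split, rule card_Un_disjoint) (use disj finite_subset[OF _ finite_monic_with_factors_in[of "insert \<phi> P" k]] finite_monic_with_factors_in in auto)
  ultimately show ?thesis by simp
qed

text \<open>Euler product by induction on P: the recurrence removes one factor at a time, until only
  the constant polynomial 1 is left to count. Dividing the k-th count by q^k is the substitution of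
  X/q for X.\<close>

lemma fps_card_monic_with_factors_in:
  fixes P :: "'a::{field,finite} poly set"
  assumes "finite P" "P \<subseteq> monic_irreducibles"
  shows "Abs_fps (\<lambda>k. real (card (monic_with_factors_in P k)) / real CARD('a) ^ k) *
    fps_of_poly (\<Prod>\<phi>\<in>P. 1 - Polynomial.monom (1 / real CARD('a) ^ Polynomial.degree \<phi>) (Polynomial.degree \<phi>)) = 1"
  using assms
proof (induction P rule: finite_induct)
  case empty
  have "Abs_fps (\<lambda>k. real (card (monic_with_factors_in ({} :: 'a poly set) k)) / real CARD('a) ^ k) = 1"
    by (rule fps_ext) (simp add: monic_with_factors_in_empty)
  then show ?case by simp
next
  case (insert \<phi> P)
  let ?A = "\<lambda>P :: 'a poly set. Abs_fps (\<lambda>k. real (card (monic_with_factors_in P k)) / real CARD('a) ^ k)"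
  let ?d = "Polynomial.degree \<phi>" and ?q = "real CARD('a)"
  let ?m = "1 - Polynomial.monom (1 / ?q ^ ?d) ?d"
  have "?A (insert \<phi> P) * fps_of_poly ?m = ?A P"
  proof (rule fps_ext)
    fix k
    have "?A (insert \<phi> P) * fps_of_poly ?m = ?A (insert \<phi> P) - fps_const (1 / ?q ^ ?d) * (?A (insert \<phi> P) * fps_X ^ ?d)"
      by (simp only: fps_of_poly_diff fps_of_poly_monom fps_of_poly_1 right_diff_distrib mult_1_right mult.left_commute)
    then have "fps_nth (?A (insert \<phi> P) * fps_of_poly ?m) k =
      fps_nth (?A (insert \<phi> P)) k - (if k < ?d then 0 else 1 / ?q ^ ?d * fps_nth (?A (insert \<phi> P)) (k - ?d))"
      by (simp add: fps_X_power_mult_right_nth del: fps_const_divide)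
    also have "\<dots> = fps_nth (?A P) k"
    proof (cases "?d \<le> k")
      case True
      have "?q ^ k = ?q ^ ?d * ?q ^ (k - ?d)" using True by (simp flip: power_add)
      then show ?thesis
        using True insert card_monic_with_factors_in_insert[of \<phi> P k] by (simp add: add_divide_distrib)
    next
      case False
      then show ?thesis using insert card_monic_with_factors_in_insert[of \<phi> P k] by simp
    qed
    finally show "fps_nth (?A (insert \<phi> P) * fps_of_poly ?m) k = fps_nth (?A P) k" .
  qed
  then have "?A (insert \<phi> P) * fps_of_poly (\<Prod>\<phi>\<in>insert \<phi> P. 1 - Polynomial.monom (1 / ?q ^ Polynomial.degree \<phi>) (Polynomial.degree \<phi>))
     = ?A P * fps_of_poly (\<Prod>\<phi>\<in>P. 1 - Polynomial.monom (1 / ?q ^ Polynomial.degree \<phi>) (Polynomial.degree \<phi>))"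
    using insert by (simp add: fps_of_poly_mult mult.assoc[symmetric])
  then show ?case using insert by simp
qed

section \<open>Convergence of the sum over squarefree polynomials\<close>

definition irreducible_sets :: "nat \<Rightarrow> 'a::field poly set set" where
  "irreducible_sets n = {S. finite S \<and> S \<subseteq> monic_irreducibles \<and> sum Polynomial.degree S = n}"

lemma finite_monic_irreducibles_degree_le:
  "finite {\<phi> :: 'a::{field,finite} poly. \<phi> \<in> monic_irreducibles \<and> Polynomial.degree \<phi> \<le> n}"
  by (rule finite_subset[OF _ finite_polys_below[of "Suc n"]]) (auto simp: polys_below_iff_degree)

lemma irreducible_sets_eq:
  "irreducible_sets n = {S \<in> Pow {\<phi> :: 'a::{field,finite} poly. \<phi> \<in> monic_irreducibles \<and> Polynomial.degree \<phi> \<le> n}.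
     sum Polynomial.degree S = n}"
proof -
  have "finite {\<phi> :: 'a poly. \<phi> \<in> monic_irreducibles \<and> Polynomial.degree \<phi> \<le> n}"
    using finite_monic_irreducibles_degree_le[where 'a='a, of n] by simp
  then show ?thesis
    unfolding irreducible_sets_def by (auto intro: finite_subset member_le_sum)
qed

text \<open>For each n the irreducibles are truncated at degree n. The truncation changes with n,
  but the bound \<open>exp 16 / (6/5) ^ n\<close> is independent of it, so the error decays
  geometrically.\<close>

lemma squarefree_sum_tendsto_1:
  "(\<lambda>n. \<Sum>S\<in>(irreducible_sets n :: 'a::{field,finite} poly set set).
      \<Prod>\<phi>\<in>S. 1 / (real CARD('a) ^ Polynomial.degree \<phi> - 1)) \<longlonglongrightarrow> 1"
proof -
  let ?q = "real CARD('a)" and ?d = "Polynomial.degree :: 'a poly \<Rightarrow> nat"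
  let ?s = "\<lambda>n. \<Sum>S\<in>(irreducible_sets n :: 'a poly set set). \<Prod>\<phi>\<in>S. 1 / (?q ^ ?d \<phi> - 1)"
  have q: "?q \<ge> 2"
    using card_mono[of UNIV "{0, 1::'a}"] by (simp add: numeral_2_eq_2)
  have "\<bar>?s n - 1\<bar> \<le> exp 16 / (6/5) ^ n" for n
  proof -
    let ?P = "{\<phi> :: 'a poly. \<phi> \<in> monic_irreducibles \<and> ?d \<phi> \<le> n}"
    let ?x = "\<lambda>\<phi>. Polynomial.monom (1 / (?q ^ ?d \<phi> - 1)) (?d \<phi>)"
    let ?A = "Abs_fps (\<lambda>k. real (card (monic_with_factors_in ?P k)) / ?q ^ k)"
    have fin: "finite ?P" using finite_monic_irreducibles_degree_le[where 'a='a, of n] by simp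
    have "?s n = (\<Sum>S\<in>Pow ?P. if sum ?d S = n then \<Prod>\<phi>\<in>S. 1 / (?q ^ ?d \<phi> - 1) else 0)"
      unfolding irreducible_sets_eq by (rule sum.inter_filter) (use fin in auto)
    also have "\<dots> = (\<Sum>S\<in>Pow ?P. Polynomial.coeff (\<Prod>\<phi>\<in>S. ?x \<phi>) n)"
    proof (rule sum.cong)
      fix S assume "S \<in> Pow ?P"
      then have "finite S" using fin by (auto intro: finite_subset)
      then have "(\<Prod>\<phi>\<in>S. ?x \<phi>) = Polynomial.monom (\<Prod>\<phi>\<in>S. 1 / (?q ^ ?d \<phi> - 1)) (sum ?d S)"
        by (induction S rule: finite_induct) (simp_all add: mult_monom monom_0)
      then show "(if sum ?d S = n then \<Prod>\<phi>\<in>S. 1 / (?q ^ ?d \<phi> - 1) else 0) = Polynomial.coeff (\<Prod>\<phi>\<in>S. ?x \<phi>) n"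
        by simp
    qed simp
    \<comment> \<open>Expanding the product of the factors 1 + x yields one monomial per subset of
      \<open>?P\<close>; its exponent is the total degree, so the coefficient of X^n selects the
      subsets of total degree n.\<close>
    also have "\<dots> = Polynomial.coeff (\<Prod>\<phi>\<in>?P. 1 + ?x \<phi>) n"
      using prod_add[OF fin, of ?x "\<lambda>_. 1"] by (simp add: coeff_sum add.commute)
    finally have s: "?s n = Polynomial.coeff (\<Prod>\<phi>\<in>?P. 1 + ?x \<phi>) n" .
    have card: "real (card {\<phi> \<in> ?P. ?d \<phi> = k}) \<le> ?q ^ k" for k
    proof -
      have "card {\<phi> \<in> ?P. ?d \<phi> = k} \<le> card {f :: 'a poly. Polynomial.lead_coeff f = 1 \<and> ?d f = k}"
        by (intro card_mono finite_monic) (auto simp: monic_irreducibles_def)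
      then show ?thesis by (simp add: card_monic flip: of_nat_power)
    qed
    \<comment> \<open>A monic polynomial of degree k \<le> n has no irreducible factor of degree
      above n, so the truncation loses none of the q^k monic polynomials.\<close>
    have A1: "fps_nth ?A k = 1" if "k \<le> n" for k
    proof -
      have "?d \<phi> \<le> n" if "\<phi> dvd f" "?d f = k" "Polynomial.lead_coeff f = 1" for \<phi> f :: "'a poly"
      proof -
        have "f \<noteq> 0" using that(3) by auto
        then show ?thesis using dvd_imp_degree_le[OF that(1)] that(2) \<open>k \<le> n\<close> by linarith
      qed
      then have "monic_with_factors_in ?P k = {f. Polynomial.lead_coeff f = 1 \<and> ?d f = k}"
        by (auto simp: monic_with_factors_in_def)
      then show ?thesis by (simp add: card_monic)
    qed
    have pos: "?d \<phi> > 0" if "\<phi> \<in> ?P" for \<phi> using that monic_irreduciblesD by blast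
    have A: "?A * fps_of_poly (\<Prod>\<phi>\<in>?P. 1 - Polynomial.monom (1 / ?q ^ ?d \<phi>) (?d \<phi>)) = 1"
      by (rule fps_card_monic_with_factors_in) (use fin in auto)
    show ?thesis unfolding s
      by (rule squarefree_coeff_bound[OF q fin pos card A A1])
  qed
  moreover have "(\<lambda>n. exp 16 / (6/5) ^ n :: real) \<longlonglongrightarrow> 0"
    by real_asymp
  ultimately have "(\<lambda>n. ?s n - 1) \<longlonglongrightarrow> 0"
    by (intro Lim_null_comparison[of "\<lambda>n. ?s n - 1" "\<lambda>n. exp 16 / (6/5) ^ n"]) auto
  then show ?thesis by (simp add: LIM_zero_iff)
qed

subsection \<open>Separability over a finite field\<close>

lemma finite_field_prime_char: "Factorial_Ring.prime CHAR('a::{field,finite})"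
  by (simp add: finite_imp_CHAR_pos prime_CHAR_semidom)

lemma frobenius_surj:
  fixes a :: "'a::{field,finite}"
  shows "\<exists>b. b ^ CHAR('a) = a"
proof -
  let ?p = "CHAR('a)"
  have prime: "Factorial_Ring.prime ?p" by (rule finite_field_prime_char)
  have "inj (\<lambda>x::'a. x ^ ?p)"
  proof (rule injI)
    fix x y :: 'a assume "x ^ ?p = y ^ ?p"
    then have "(x - y + y) ^ ?p = y ^ ?p" by simp
    then have "(x - y) ^ ?p = 0" unfolding freshmans_dream[OF prime refl] by simp
    then show "x = y" by simp
  qed
  then have "surj (\<lambda>x::'a. x ^ ?p)" by (rule finite_UNIV_inj_surj[OF finite])
  then show ?thesis by (metis surjD)
qed

text \<open>A zero derivative leaves only exponents divisible by the characteristic p. Over a finite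
  field the remaining coefficients have p-th roots, and because p-th powers are additive, the
  polynomial with these roots as coefficients is a p-th root of f.\<close>

lemma pderiv_eq_0_imp_power:
  fixes f :: "'a::{field,finite} poly"
  assumes "pderiv f = 0"
  shows "\<exists>g. f = g ^ CHAR('a)"
proof -
  let ?p = "CHAR('a)" and ?N = "Polynomial.degree f"
  have prime: "Factorial_Ring.prime ?p" by (rule finite_field_prime_char)
  then have p: "?p > 0" by (rule prime_gt_0_nat)
  have coeff_0: "Polynomial.coeff f j = 0" if "\<not> ?p dvd j" for j
  proof (cases j)
    case (Suc i)
    have "of_nat (Suc i) * Polynomial.coeff f (Suc i) = Polynomial.coeff (pderiv f) i" by (simp only: coeff_pderiv)
    then have "of_nat j * Polynomial.coeff f j = 0" using assms Suc by (simp del: of_nat_Suc)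
    then show ?thesis using that of_nat_eq_0_iff_char_dvd by (metis mult_eq_0_iff)
  qed (use that in simp)
  have "\<exists>b. \<forall>i. b i ^ ?p = Polynomial.coeff f (i * ?p)" using frobenius_surj by (intro choice) blast
  then obtain b where b: "\<And>i. b i ^ ?p = Polynomial.coeff f (i * ?p)" by blast
  \<comment> \<open>Summing up to \<open>?N\<close> rather than \<open>?N\<close> / p is harmless:
    the extra terms belong to exponents beyond the degree of f, where the coefficient is 0.\<close>
  have "(\<Sum>i\<le>?N. Polynomial.monom (b i) i) ^ ?p = (\<Sum>i\<le>?N. Polynomial.monom (b i) i ^ ?p)"
    by (rule freshmans_dream_sum) (simp_all add: prime)
  also have "\<dots> = (\<Sum>i\<le>?N. Polynomial.monom (Polynomial.coeff f (i * ?p)) (i * ?p))"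
    by (simp add: monom_power b)
  also have "\<dots> = f"
  proof (rule poly_eqI)
    fix j
    have "Polynomial.coeff (\<Sum>i\<le>?N. Polynomial.monom (Polynomial.coeff f (i * ?p)) (i * ?p)) j
      = (\<Sum>i\<le>?N. if i * ?p = j then Polynomial.coeff f j else 0)"
      by (auto simp: coeff_sum intro!: sum.cong)
    also have "\<dots> = Polynomial.coeff f j"
    proof (cases "?p dvd j \<and> j \<le> ?N")
      case True
      then obtain i where i: "j = i * ?p" by (auto simp: dvd_def mult.commute)
      then have "i \<le> ?N" using True p by (metis le_trans mult_le_mono2 nat_mult_1_right Suc_leI One_nat_def)
      then show ?thesis using p by (simp add: i)
    next
      case False
      then have "Polynomial.coeff f j = 0" using coeff_0 coeff_eq_0 by (metis not_le)
      then show ?thesis by (simp cong: if_cong)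
    qed
    finally show "Polynomial.coeff (\<Sum>i\<le>?N. Polynomial.monom (Polynomial.coeff f (i * ?p)) (i * ?p)) j = Polynomial.coeff f j" .
  qed
  finally show ?thesis by metis
qed

lemma pderiv_monic_irreducible_neq_0:
  fixes \<phi> :: "'a::{field,finite} poly"
  assumes "\<phi> \<in> monic_irreducibles"
  shows "pderiv \<phi> \<noteq> 0"
proof
  assume "pderiv \<phi> = 0"
  then obtain g where g: "\<phi> = g ^ CHAR('a)" using pderiv_eq_0_imp_power by blast
  have p: "CHAR('a) > 1" using finite_field_prime_char by (rule prime_gt_1_nat)
  have "prime_elem \<phi>" using assms by (rule monic_irreduciblesD)
  then have "\<phi> dvd g" using g prime_elem_dvd_power by (metis dvd_refl)
  moreover have "g \<noteq> 0" using g p monic_irreduciblesD(2)[OF assms] by auto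
  ultimately have "Polynomial.degree \<phi> \<le> Polynomial.degree g" by (rule dvd_imp_degree_le)
  moreover have "Polynomial.degree \<phi> = CHAR('a) * Polynomial.degree g"
    by (simp add: g degree_power_eq[OF \<open>g \<noteq> 0\<close>])
  moreover have "Polynomial.degree \<phi> > 0" using assms by (rule monic_irreduciblesD)
  ultimately show False using p by auto
qed

text \<open>Writing \<open>\<Prod>S\<close> as \<phi> h, the derivative is congruent to h \<phi>'
  modulo \<phi>. Neither factor is divisible by \<phi>: h is a product of other irreducibles, and
  \<phi>' is nonzero of smaller degree.\<close>

lemma not_dvd_pderiv_prod_monic_irreducibles:
  fixes S :: "'a::{field,finite} poly set"
  assumes S: "finite S" "S \<subseteq> monic_irreducibles" and \<phi>: "\<phi> \<in> monic_irreducibles" "\<phi> dvd \<Prod>S"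
  shows "\<not> \<phi> dvd pderiv (\<Prod>S)"
proof
  assume dvd: "\<phi> dvd pderiv (\<Prod>S)"
  note \<phi>' = monic_irreduciblesD[OF \<phi>(1)]
  have in_S: "\<phi> \<in> S" using dvd_prod_monic_irreducibles_iff[OF S \<phi>(1)] \<phi>(2) by simp
  let ?h = "\<Prod>(S - {\<phi>})"
  have "\<Prod>S = \<phi> * ?h" using prod.remove[OF S(1) in_S] .
  then have "pderiv (\<Prod>S) = \<phi> * pderiv ?h + ?h * pderiv \<phi>" by (simp add: pderiv_mult)
  then have "\<phi> dvd ?h * pderiv \<phi>" using dvd by (simp add: dvd_add_right_iff)
  moreover have "\<not> \<phi> dvd ?h"
    using dvd_prod_monic_irreducibles_iff[of "S - {\<phi>}" \<phi>] S \<phi>(1) by blast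
  ultimately have "\<phi> dvd pderiv \<phi>" using \<phi>'(4) by (simp add: prime_elem_dvd_mult_iff)
  moreover have "pderiv \<phi> \<noteq> 0" using \<phi>(1) by (rule pderiv_monic_irreducible_neq_0)
  ultimately have "Polynomial.degree \<phi> \<le> Polynomial.degree (pderiv \<phi>)" by (rule dvd_imp_degree_le)
  moreover have "Polynomial.degree (pderiv \<phi>) \<le> Polynomial.degree \<phi> - 1"
    by (rule degree_pderiv_le)
  ultimately show False using \<phi>'(3) by simp
qed

section \<open>Roots in the algebraic closure\<close>

interpretation to_ac: field_hom to_ac by standard auto
interpretation to_ac_poly: map_poly_inj_idom_hom to_ac ..

text \<open>A nonzero polynomial over F of least degree vanishing at a is, up to a scalar, the
  minimal polynomial of a. By division with remainder it divides every polynomial over F with root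
  a, so its irreducible factors are common to f and g.\<close>

lemma common_root_imp_common_factor:
  fixes f g :: "'a::field poly"
  assumes "f \<noteq> 0" "poly (map_poly to_ac f) a = 0" "poly (map_poly to_ac g) a = 0"
  shows "\<exists>\<phi>\<in>monic_irreducibles. \<phi> dvd f \<and> \<phi> dvd g"
proof -
  let ?root = "\<lambda>p. poly (map_poly to_ac p) a = 0"
  define p where "p = arg_min Polynomial.degree (\<lambda>p. p \<noteq> 0 \<and> ?root p)"
  have p: "p \<noteq> 0" "?root p" and min: "\<And>r. r \<noteq> 0 \<Longrightarrow> ?root r \<Longrightarrow> Polynomial.degree p \<le> Polynomial.degree r"
    using arg_min_nat_lemma[of "\<lambda>p. p \<noteq> 0 \<and> ?root p" f Polynomial.degree] assms unfolding p_def by auto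
  have dvd: "p dvd r" if "?root r" for r
  proof -
    have "map_poly to_ac r = map_poly to_ac (r div p) * map_poly to_ac p + map_poly to_ac (r mod p)"
      by (simp flip: to_ac_poly.hom_mult to_ac_poly.hom_add)
    then have "?root (r mod p)" using that p by simp
    then have "r mod p = 0" using min[of "r mod p"] degree_mod_less[OF p(1), of r] by force
    then show ?thesis by (simp add: dvd_eq_mod_eq_0)
  qed
  have "Polynomial.degree p \<noteq> 0"
  proof
    assume "Polynomial.degree p = 0"
    then obtain c where "p = [:c:]" by (elim degree_eq_zeroE)
    then show False using p by simp
  qed
  then obtain \<phi> where "\<phi> \<in> monic_irreducibles" "\<phi> dvd p" using exists_monic_irreducible_dvd[of p] by auto
  then show ?thesis using dvd[OF assms(2)] dvd[OF assms(3)] dvd_trans by blast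
qed

text \<open>A repeated root of \<open>\<Prod>S\<close> would also be a root of its derivative. The
  common root descends to a common irreducible factor over F, which separability excludes.\<close>

lemma distinct_roots_prod_monic_irreducibles:
  fixes S :: "'a::{field,finite} poly set"
  assumes S: "finite S" "S \<subseteq> monic_irreducibles"
  shows "\<exists>xs. distinct xs \<and> length xs = Polynomial.degree (\<Prod>S) \<and> (\<forall>x\<in>set xs. poly (map_poly to_ac (\<Prod>S)) x = 0)"
proof -
  let ?f = "\<Prod>S" and ?F = "map_poly to_ac (\<Prod>S)"
  have "\<Prod>S \<noteq> 0" using lead_coeff_prod_monic_irreducibles[OF S(2)] by auto
  then have F0: "?F \<noteq> 0" by simp
  obtain A where A: "size A = Polynomial.degree ?F" "?F = Polynomial.smult (Polynomial.lead_coeff ?F) (\<Prod>x\<in>#A. [:-x, 1:])"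
    using alg_closed_imp_factorization[OF F0] by blast
  obtain xs where xs: "mset xs = A" using ex_mset by blast
  define c where "c = Polynomial.lead_coeff ?F"
  have "(\<Prod>x\<in>#A. [:-x, 1:]) = prod_list (map (\<lambda>x. [:-x, 1:]) xs)"
    unfolding xs[symmetric] mset_map[symmetric] prod_mset_prod_list ..
  with A(2)[folded c_def] have F: "?F = Polynomial.smult c (prod_list (map (\<lambda>x. [:-x, 1:]) xs))" by metis
  have root: "poly ?F x = 0" if "x \<in> set xs" for x
  proof -
    from split_list[OF that] obtain us vs where "xs = us @ x # vs" by blast
    then show ?thesis by (simp add: F)
  qed
  have "distinct xs"
  proof (rule ccontr)
    assume "\<not> distinct xs"
    then obtain us vs ws x where dec: "xs = us @ [x] @ vs @ [x] @ ws" using not_distinct_decomp by blast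
    define H where "H = Polynomial.smult c (prod_list (map (\<lambda>x. [:-x, 1:]) (us @ vs @ ws)))"
    have "?F = [:-x, 1:] * ([:-x, 1:] * H)" 
      by (simp only: F H_def dec map_append prod_list.append list.map prod_list.Cons prod_list.Nil mult_1_left mult_1_right
          mult_smult_right mult_smult_left mult_ac)
    then have "poly (pderiv ?F) x = 0" by (simp only: pderiv_mult poly_add poly_mult) simp
    then have "poly (map_poly to_ac (pderiv ?f)) x = 0" by (simp add: to_ac.map_poly_pderiv)
    moreover have "poly ?F x = 0" using root dec by simp
    ultimately obtain \<phi> where "\<phi> \<in> monic_irreducibles" "\<phi> dvd ?f" "\<phi> dvd pderiv ?f"
      using common_root_imp_common_factor[OF \<open>\<Prod>S \<noteq> 0\<close>] by blast
    then show False using not_dvd_pderiv_prod_monic_irreducibles[OF S] by blast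
  qed
  moreover have "length xs = Polynomial.degree ?f" using A(1) xs by (metis size_mset to_ac.degree_map_poly_hom)
  ultimately show ?thesis using root by blast
qed

subsection \<open>Counting invertible matrices\<close>

lemma bij_betw_vec_coords:
  "bij_betw (\<lambda>v. restrict (vec_index v) {..<n}) (carrier_vec n) (PiE {..<n} (\<lambda>_. UNIV))"
  by (rule bij_betw_byWitness[where f' = "\<lambda>g. vec n g"])
    (auto simp: restrict_def PiE_def extensional_def fun_eq_iff)

lemma card_carrier_vec: "card (carrier_vec n :: 'a::finite Matrix.vec set) = CARD('a) ^ n"
  using bij_betw_same_card[OF bij_betw_vec_coords[where 'a='a, of n]] by (simp add: card_PiE)

lemma finite_carrier_vec: "finite (carrier_vec n :: 'a::finite Matrix.vec set)"
  using bij_betw_finite[OF bij_betw_vec_coords[where 'a='a, of n]] by (simp add: finite_PiE)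

lemma bij_betw_mat_coords:
  "bij_betw (\<lambda>A. restrict (index_mat A) ({..<n} \<times> {..<k})) (carrier_mat n k)
    (PiE ({..<n} \<times> {..<k}) (\<lambda>_. UNIV))"
  by (rule bij_betw_byWitness[where f' = "\<lambda>g. mat n k g"])
    (auto simp: restrict_def PiE_def extensional_def fun_eq_iff)

lemma card_carrier_mat: "card (carrier_mat n k :: 'a::finite mat set) = CARD('a) ^ (n * k)"
  using bij_betw_same_card[OF bij_betw_mat_coords[where 'a='a, of n k]] by (simp add: card_PiE)

lemma finite_carrier_mat: "finite (carrier_mat n k :: 'a::finite mat set)"
  using bij_betw_finite[OF bij_betw_mat_coords[where 'a='a, of n k]] by (simp add: finite_PiE)

text \<open>The rectangular form allows induction on the number of columns; for k = n these are the
  invertible matrices.\<close>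

definition injective_mats :: "nat \<Rightarrow> nat \<Rightarrow> 'a::field mat set" where
  "injective_mats n k = {A \<in> carrier_mat n k. \<forall>x\<in>carrier_vec k. A *\<^sub>v x = 0\<^sub>v n \<longrightarrow> x = 0\<^sub>v k}"

definition append_col :: "'a mat \<Rightarrow> 'a Matrix.vec \<Rightarrow> 'a mat" where
  "append_col A w = mat (dim_row A) (Suc (dim_col A)) (\<lambda>(i, j). if j < dim_col A then A $$ (i, j) else w $ i)"

lemma append_col_mult_vec:
  fixes A :: "'a::comm_semiring_0 mat"
  assumes "A \<in> carrier_mat n k" "w \<in> carrier_vec n" "x \<in> carrier_vec (Suc k)"
  shows "append_col A w *\<^sub>v x = A *\<^sub>v vec k (vec_index x) + x $ k \<cdot>\<^sub>v w"
proof (rule eq_vecI)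
  fix i assume "i < dim_vec (A *\<^sub>v vec k (vec_index x) + x $ k \<cdot>\<^sub>v w)"
  then show "(append_col A w *\<^sub>v x) $ i = (A *\<^sub>v vec k (vec_index x) + x $ k \<cdot>\<^sub>v w) $ i"
    using assms by (auto simp: append_col_def scalar_prod_def ac_simps atLeast0_lessThan_Suc)
qed (use assms in \<open>auto simp: append_col_def\<close>)

lemma injective_mats_inj:
  fixes A :: "'a::field mat"
  assumes "A \<in> injective_mats n k"
  shows "inj_on (\<lambda>x. A *\<^sub>v x) (carrier_vec k)"
proof (rule inj_onI)
  fix x y assume xy: "x \<in> carrier_vec k" "y \<in> carrier_vec k" "A *\<^sub>v x = A *\<^sub>v y"
  have A: "A \<in> carrier_mat n k" using assms by (simp add: injective_mats_def)
  have "A *\<^sub>v (x - y) = 0\<^sub>v n" using A xy by (simp add: mult_minus_distrib_mat_vec)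
  then have "x - y = 0\<^sub>v k" using assms xy by (simp add: injective_mats_def)
  then show "x = y"
  proof (intro eq_vecI)
    fix i assume "i < dim_vec y"
    then have i: "i < k" using xy by simp
    then have "(x - y) $ i = 0" using \<open>x - y = 0\<^sub>v k\<close> by simp
    then show "x $ i = y $ i" using i xy by simp
  qed (use xy in simp)
qed

lemma smult_zero_vec: "0 \<cdot>\<^sub>v w = 0\<^sub>v n" if "w \<in> carrier_vec n" for w :: "'a::mult_zero Matrix.vec"
  using that by (intro eq_vecI) auto

text \<open>A kernel vector of the enlarged matrix with nonzero last entry expresses w through the
  columns of A; one with last entry 0 is a kernel vector of A.\<close>

lemma append_col_injective_iff:
  fixes A :: "'a::field mat"
  assumes A: "A \<in> carrier_mat n k" and w: "w \<in> carrier_vec n"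
  shows "append_col A w \<in> injective_mats n (Suc k) \<longleftrightarrow>
    A \<in> injective_mats n k \<and> w \<notin> (\<lambda>x. A *\<^sub>v x) ` carrier_vec k"
proof (intro iffI conjI)
  have B: "append_col A w \<in> carrier_mat n (Suc k)" using A by (auto simp: append_col_def)
  let ?ext = "\<lambda>(x :: 'a Matrix.vec) c. vec (Suc k) (\<lambda>i. if i < k then x $ i else c)"
  have ext: "append_col A w *\<^sub>v ?ext x c = A *\<^sub>v x + c \<cdot>\<^sub>v w" if "x \<in> carrier_vec k" for x c
  proof -
    have "vec k (vec_index (?ext x c)) = x" using that by (intro eq_vecI) auto
    then show ?thesis by (subst append_col_mult_vec[OF A w]) auto
  qed
  {
    assume inj: "append_col A w \<in> injective_mats n (Suc k)"
    have "x = 0\<^sub>v k" if x: "x \<in> carrier_vec k" "A *\<^sub>v x = 0\<^sub>v n" for x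
    proof (rule eq_vecI)
      have "append_col A w *\<^sub>v ?ext x 0 = 0\<^sub>v n" using ext[OF x(1)] x(2) w by (simp add: smult_zero_vec)
      then have "?ext x 0 = 0\<^sub>v (Suc k)" using inj by (simp add: injective_mats_def)
      then show "x $ i = 0\<^sub>v k $ i" if "i < dim_vec (0\<^sub>v k)" for i
      proof -
        have "?ext x 0 $ i = 0" using \<open>?ext x 0 = 0\<^sub>v (Suc k)\<close> that by simp
        then show ?thesis using that by simp
      qed
    qed (use x in simp)
    then show "A \<in> injective_mats n k" using A by (simp add: injective_mats_def)
    show "w \<notin> (\<lambda>x. A *\<^sub>v x) ` carrier_vec k"
    proof
      assume "w \<in> (\<lambda>x. A *\<^sub>v x) ` carrier_vec k"
      then obtain x where x: "x \<in> carrier_vec k" "w = A *\<^sub>v x" by blast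
      \<comment> \<open>Since w = A x, appending -1 to x gives a kernel vector that is visibly
        nonzero in its last entry.\<close>
      have "append_col A w *\<^sub>v ?ext x (-1) = 0\<^sub>v n"
        unfolding ext[OF x(1)] x(2)[symmetric] using w by (intro eq_vecI) auto
      then have "?ext x (-1) = 0\<^sub>v (Suc k)" using inj by (simp add: injective_mats_def)
      then have "?ext x (-1) $ k = 0" by simp
      then show False by simp
    qed
  }
  assume inj: "A \<in> injective_mats n k \<and> w \<notin> (\<lambda>x. A *\<^sub>v x) ` carrier_vec k"
  have "x = 0\<^sub>v (Suc k)" if x: "x \<in> carrier_vec (Suc k)" "append_col A w *\<^sub>v x = 0\<^sub>v n" for x
  proof -
    let ?y = "vec k (vec_index x)"
    have eq: "A *\<^sub>v ?y + x $ k \<cdot>\<^sub>v w = 0\<^sub>v n" using x append_col_mult_vec[OF A w x(1)] by simp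
    have xk: "x $ k = 0"
    proof (rule ccontr)
      assume nz: "x $ k \<noteq> 0"
      have "w = A *\<^sub>v ((- inverse (x $ k)) \<cdot>\<^sub>v ?y)"
      proof (rule eq_vecI)
        fix i assume "i < dim_vec (A *\<^sub>v ((- inverse (x $ k)) \<cdot>\<^sub>v ?y))"
        then have i: "i < n" using A by simp
        have "(A *\<^sub>v ?y) $ i + x $ k * w $ i = 0"
          using arg_cong[OF eq, of "\<lambda>v :: 'a Matrix.vec. v $ i"] i A w by simp
        then have "w $ i = - inverse (x $ k) * (A *\<^sub>v ?y) $ i"
          using nz by (simp add: field_simps eq_neg_iff_add_eq_0)
        then show "w $ i = (A *\<^sub>v ((- inverse (x $ k)) \<cdot>\<^sub>v ?y)) $ i"
          using i A by (subst mult_mat_vec[OF A]) auto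
      qed (use A w in simp)
      then show False using inj by auto
    qed
    then have "A *\<^sub>v ?y = 0\<^sub>v n" using eq A w by (simp add: smult_zero_vec)
    then have y: "?y = 0\<^sub>v k" using inj by (simp add: injective_mats_def)
    show ?thesis
    proof (rule eq_vecI)
      fix i assume "i < dim_vec (0\<^sub>v (Suc k))"
      then consider "i < k" | "i = k" by force
      then show "x $ i = 0\<^sub>v (Suc k) $ i"
      proof cases
        case 1
        then have "x $ i = ?y $ i" by simp
        then show ?thesis using y 1 by simp
      qed (simp add: xk)
    qed (use x in simp)
  qed
  then show "append_col A w \<in> injective_mats n (Suc k)" using B by (simp add: injective_mats_def)
qed

lemma bij_betw_append_col:
  "bij_betw (\<lambda>(A, w). append_col A w) (carrier_mat n k \<times> carrier_vec n) (carrier_mat n (Suc k))"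
  by (rule bij_betw_byWitness[where f' = "\<lambda>B. (mat n k (index_mat B), col B k)"])
    (auto simp: append_col_def less_Suc_eq intro!: eq_matI eq_vecI)

text \<open>The admissible new columns are those outside the column span, which has q^k elements
  because the matrix is injective on vectors of length k.\<close>

lemma card_injective_mats_Suc:
  "card (injective_mats n (Suc k) :: 'a::{field,finite} mat set) =
    card (injective_mats n k :: 'a mat set) * (CARD('a) ^ n - CARD('a) ^ k)"
proof -
  let ?D = "SIGMA A : (injective_mats n k :: 'a mat set). carrier_vec n - (\<lambda>x. A *\<^sub>v x) ` carrier_vec k"
  have fin: "finite (injective_mats n k :: 'a mat set)"
    by (rule finite_subset[OF _ finite_carrier_mat[of n k]]) (auto simp: injective_mats_def)
  have sub: "?D \<subseteq> carrier_mat n k \<times> carrier_vec n" by (auto simp: injective_mats_def)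
  have "(\<lambda>(A, w). append_col A w) ` ?D = injective_mats n (Suc k)"
  proof (intro equalityI subsetI)
    fix B assume "B \<in> (\<lambda>(A, w). append_col A w) ` ?D"
    then obtain A w where "A \<in> injective_mats n k" "w \<in> carrier_vec n - (\<lambda>x. A *\<^sub>v x) ` carrier_vec k" "B = append_col A w"
      by (elim imageE SigmaE) simp
    then show "B \<in> injective_mats n (Suc k)" using append_col_injective_iff[of A n k w] by (simp add: injective_mats_def)
  next
    fix B :: "'a mat" assume B: "B \<in> injective_mats n (Suc k)"
    then have "B \<in> carrier_mat n (Suc k)" by (simp add: injective_mats_def)
    then have "B \<in> (\<lambda>(A, w). append_col A w) ` (carrier_mat n k \<times> carrier_vec n)"
      by (simp only: bij_betw_imp_surj_on[OF bij_betw_append_col])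
    then obtain A w where Aw: "A \<in> carrier_mat n k" "w \<in> carrier_vec n" "B = append_col A w"
      by (elim imageE SigmaE) simp
    then have "(A, w) \<in> ?D" using B append_col_injective_iff[OF Aw(1,2)] by simp
    then show "B \<in> (\<lambda>(A, w). append_col A w) ` ?D" using Aw(3) by (intro image_eqI[of _ _ "(A, w)"]) simp_all
  qed
  moreover have "inj_on (\<lambda>(A, w). append_col A w) ?D"
    using bij_betw_imp_inj_on[OF bij_betw_append_col] sub by (rule inj_on_subset)
  ultimately have "card (injective_mats n (Suc k) :: 'a mat set) = card ?D" by (metis card_image)
  also have "\<dots> = (\<Sum>A\<in>(injective_mats n k :: 'a mat set). card (carrier_vec n - (\<lambda>x. A *\<^sub>v x) ` carrier_vec k))"
    by (rule card_SigmaI) (use fin finite_carrier_vec in auto)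
  also have "\<dots> = (\<Sum>A\<in>(injective_mats n k :: 'a mat set). CARD('a) ^ n - CARD('a) ^ k)"
  proof (rule sum.cong[OF refl])
    fix A :: "'a mat" assume A: "A \<in> injective_mats n k"
    then have "(\<lambda>x. A *\<^sub>v x) ` carrier_vec k \<subseteq> carrier_vec n" by (auto simp: injective_mats_def)
    then show "card (carrier_vec n - (\<lambda>x. A *\<^sub>v x) ` carrier_vec k) = CARD('a) ^ n - CARD('a) ^ k"
      using injective_mats_inj[OF A]
      by (simp add: card_Diff_subset finite_carrier_vec card_image card_carrier_vec)
  qed
  finally show ?thesis by simp
qed

lemma card_injective_mats:
  "card (injective_mats n k :: 'a::{field,finite} mat set) = (\<Prod>i<k. CARD('a) ^ n - CARD('a) ^ i)"
proof (induction k)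
  case 0
  have "injective_mats n 0 = (carrier_mat n 0 :: 'a mat set)" by (auto simp: injective_mats_def)
  then show ?case by (simp add: card_carrier_mat)
next
  case (Suc k)
  then show ?case by (simp add: card_injective_mats_Suc mult.commute)
qed

text \<open>Each of the n columns takes its own q^n from the denominator. Reversing the order of the
  factors, i = n - 1 - r, makes the product an initial segment of the infinite one.\<close>

lemma card_injective_mats_fraction:
  "real (card (injective_mats n n :: 'a::{field,finite} mat set)) / real CARD('a) ^ (n * n) =
    (\<Prod>r<n. 1 - 1 / real CARD('a) ^ Suc r)"
proof -
  let ?q = "real CARD('a)"
  have "real (card (injective_mats n n :: 'a mat set)) = (\<Prod>i<n. ?q ^ n - ?q ^ i)"
    unfolding card_injective_mats of_nat_prod
    by (intro prod.cong refl) (simp add: of_nat_diff power_increasing)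
  also have "\<dots> / ?q ^ (n * n) = (\<Prod>i<n. (?q ^ n - ?q ^ i) / ?q ^ n)"
    by (simp add: prod_dividef power_mult)
  also have "\<dots> = (\<Prod>r<n. (?q ^ n - ?q ^ (n - Suc r)) / ?q ^ n)"
    by (rule prod.nat_diff_reindex[symmetric])
  also have "\<dots> = (\<Prod>r<n. 1 - 1 / ?q ^ Suc r)"
  proof (intro prod.cong refl)
    fix r assume "r \<in> {..<n}"
    then have "n = (n - Suc r) + Suc r" by simp
    then have "?q ^ n = ?q ^ (n - Suc r) * ?q ^ Suc r" by (metis power_add)
    then show "(?q ^ n - ?q ^ (n - Suc r)) / ?q ^ n = 1 - 1 / ?q ^ Suc r"
      by (simp add: diff_divide_distrib)
  qed
  finally show ?thesis .
qed

subsection \<open>Cyclic vectors\<close>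

text \<open>The F[z]-module structure with z acting as A, evaluated by Horner's rule on vectors. No
  matrix p(A) is formed, and induction on \<open>pCons\<close> applies directly.\<close>

definition poly_act :: "'a::comm_ring_1 mat \<Rightarrow> 'a poly \<Rightarrow> 'a Matrix.vec \<Rightarrow> 'a Matrix.vec" where
  "poly_act A p v = fold_coeffs (\<lambda>a w. a \<cdot>\<^sub>v v + A *\<^sub>v w) p (0\<^sub>v (dim_vec v))"

lemma mult_mat_zero_vec: "A *\<^sub>v 0\<^sub>v k = 0\<^sub>v n" if "A \<in> carrier_mat n k" for A :: "'a::comm_ring_1 mat"
  using that by (intro eq_vecI) auto

lemma mult_mat_smult_vec:
  fixes A :: "'a::comm_ring_1 mat"
  assumes "A \<in> carrier_mat n k" "v \<in> carrier_vec k"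
  shows "A *\<^sub>v (c \<cdot>\<^sub>v v) = c \<cdot>\<^sub>v (A *\<^sub>v v)"
  using assms by (intro eq_vecI) (auto simp: scalar_prod_def sum_distrib_left mult.left_commute)

lemma smult_vec_zero: "c \<cdot>\<^sub>v 0\<^sub>v n = 0\<^sub>v n" for c :: "'a::comm_ring_1"
  by (intro eq_vecI) auto

lemma poly_act_0 [simp]: "v \<in> carrier_vec n \<Longrightarrow> poly_act A 0 v = 0\<^sub>v n"
  by (auto simp: poly_act_def)

lemma poly_act_pCons:
  fixes A :: "'a::comm_ring_1 mat"
  assumes "A \<in> carrier_mat n n" "v \<in> carrier_vec n"
  shows "poly_act A (pCons a p) v = a \<cdot>\<^sub>v v + A *\<^sub>v poly_act A p v"
proof (cases "p = 0 \<and> a = 0")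
  case True
  have "0 \<cdot>\<^sub>v v + A *\<^sub>v 0\<^sub>v n = 0\<^sub>v n" using assms by (intro eq_vecI) auto
  then show ?thesis using True assms by (simp add: poly_act_0)
next
  case False
  then show ?thesis unfolding poly_act_def by (cases "p = 0") (auto simp: fold_coeffs_pCons_coeff_not_0_eq fold_coeffs_pCons_not_0_0_eq)
qed

lemma poly_act_closed [simp, intro]:
  "poly_act A p v \<in> carrier_vec n" if "A \<in> carrier_mat n n" "v \<in> carrier_vec n"
  by (induction p) (use that in \<open>simp_all add: poly_act_pCons\<close>)

lemma dim_poly_act: "dim_vec (poly_act A p v) = n" if "A \<in> carrier_mat n n" "v \<in> carrier_vec n"
  using poly_act_closed[OF that] by simp

lemma poly_act_add:
  assumes "A \<in> carrier_mat n n" "v \<in> carrier_vec n"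
  shows "poly_act A (p + r) v = poly_act A p v + poly_act A r v"
proof (induction p r rule: poly_induct2)
  case 0
  then show ?case using assms by simp
next
  case (pCons a p b r)
  have "A *\<^sub>v (poly_act A p v + poly_act A r v) = A *\<^sub>v poly_act A p v + A *\<^sub>v poly_act A r v"
    using assms by (simp add: mult_add_distrib_mat_vec)
  then show ?case using assms pCons
    by (auto simp: poly_act_pCons algebra_simps intro!: eq_vecI)
qed

lemma poly_act_smult:
  assumes "A \<in> carrier_mat n n" "v \<in> carrier_vec n"
  shows "poly_act A (Polynomial.smult c p) v = c \<cdot>\<^sub>v poly_act A p v"
proof (induction p)
  case 0
  then show ?case using assms by (simp add: smult_vec_zero)
next
  case (pCons a p)
  have "A *\<^sub>v (c \<cdot>\<^sub>v poly_act A p v) = c \<cdot>\<^sub>v (A *\<^sub>v poly_act A p v)"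
    by (rule mult_mat_smult_vec[OF assms(1) poly_act_closed[OF assms]])
  then show ?case using assms pCons
    by (auto simp: poly_act_pCons algebra_simps intro!: eq_vecI)
qed

lemma poly_act_diff:
  assumes "A \<in> carrier_mat n n" "v \<in> carrier_vec n"
  shows "poly_act A (p - r) v = poly_act A p v - poly_act A r v"
proof -
  have "p - r = p + Polynomial.smult (-1) r" by simp
  then show ?thesis using assms
    by (simp only: poly_act_add poly_act_smult) (auto simp: dim_poly_act intro!: eq_vecI)
qed

text \<open>An intertwiner P is a homomorphism of F[z]-modules. It serves to move annihilation
  statements between similar matrices.\<close>

lemma poly_act_intertwine:
  assumes "A \<in> carrier_mat n n" "B \<in> carrier_mat k k" "P \<in> carrier_mat n k" "v \<in> carrier_vec k" "A * P = P * B"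
  shows "poly_act A p (P *\<^sub>v v) = P *\<^sub>v poly_act B p v"
proof (induction p)
  case 0
  then show ?case using assms by (simp add: mult_mat_zero_vec poly_act_0[of _ n])
next
  case (pCons a p)
  have "A *\<^sub>v (P *\<^sub>v poly_act B p v) = (A * P) *\<^sub>v poly_act B p v"
    using assms by (intro assoc_mult_mat_vec[symmetric]) auto
  also have "\<dots> = P *\<^sub>v (B *\<^sub>v poly_act B p v)" using assms by (simp add: assoc_mult_mat_vec)
  finally show ?case
    using assms pCons by (simp add: poly_act_pCons mult_add_distrib_mat_vec mult_mat_smult_vec[OF assms(3,4)])
qed

lemma poly_act_monom_Suc:
  assumes "A \<in> carrier_mat n n" "v \<in> carrier_vec n"
  shows "poly_act A (Polynomial.monom a (Suc j)) v = A *\<^sub>v poly_act A (Polynomial.monom a j) v"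
  using assms by (simp add: monom_Suc poly_act_pCons smult_zero_vec)

lemma poly_act_1: "poly_act A 1 v = v" if "A \<in> carrier_mat n n" "v \<in> carrier_vec n"
  using that unfolding one_pCons by (simp add: poly_act_pCons mult_mat_zero_vec)

lemma poly_act_mult:
  assumes "A \<in> carrier_mat n n" "v \<in> carrier_vec n"
  shows "poly_act A (p * r) v = poly_act A p (poly_act A r v)"
proof (induction p)
  case 0
  then show ?case using assms by (simp add: poly_act_0[OF poly_act_closed[OF assms]])
next
  case (pCons a p)
  have "poly_act A (pCons 0 (p * r)) v = A *\<^sub>v poly_act A (p * r) v"
    using assms by (simp add: poly_act_pCons smult_zero_vec)
  then show ?case using assms pCons
    by (simp add: poly_act_add poly_act_smult poly_act_pCons[OF assms(1) poly_act_closed[OF assms]])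
qed

lemma poly_act_zero_vec:
  assumes "A \<in> carrier_mat n n"
  shows "poly_act A p (0\<^sub>v n) = 0\<^sub>v n"
  by (induction p) (use assms in \<open>simp_all add: poly_act_pCons mult_mat_zero_vec smult_vec_zero\<close>)

lemma poly_act_commute:
  assumes "A \<in> carrier_mat n n" "v \<in> carrier_vec n"
  shows "poly_act A p (poly_act A r v) = poly_act A r (poly_act A p v)"
  by (simp only: poly_act_mult[OF assms, symmetric] mult.commute)

lemma poly_act_index:
  assumes A: "A \<in> carrier_mat n n" and v: "v \<in> carrier_vec n" and p: "p \<in> polys_below k" and i: "i < n"
  shows "poly_act A p v $ i = (\<Sum>j<k. Polynomial.coeff p j * (poly_act A (Polynomial.monom 1 j) v $ i))"
proof -
  have sum: "poly_act A (sum f J) v $ i = (\<Sum>j\<in>J. poly_act A (f j) v $ i)" if "finite J" for f :: "nat \<Rightarrow> 'a poly" and J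
    using that by (induction J rule: finite_induct) (use A v i in \<open>simp_all add: poly_act_add dim_poly_act\<close>)
  have p_eq: "p = (\<Sum>j<k. Polynomial.smult (Polynomial.coeff p j) (Polynomial.monom 1 j))"
    using p by (intro poly_eqI) (auto simp: coeff_sum polys_below_def smult_monom not_less[symmetric])
  have "poly_act A p v $ i = (\<Sum>j<k. poly_act A (Polynomial.smult (Polynomial.coeff p j) (Polynomial.monom 1 j)) v $ i)"
    by (rule trans[OF arg_cong[OF p_eq, of "\<lambda>r. vec_index (poly_act A r v) i"] sum[OF finite_lessThan]])
  also have "\<dots> = (\<Sum>j<k. Polynomial.coeff p j * (poly_act A (Polynomial.monom 1 j) v $ i))"
    using A v i by (simp add: poly_act_smult dim_poly_act del: smult_monom)
  finally show ?thesis .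
qed

lemma poly_act_mod:
  fixes A :: "'a::field mat"
  assumes "A \<in> carrier_mat n n" "v \<in> carrier_vec n" "poly_act A f v = 0\<^sub>v n"
  shows "poly_act A (p mod f) v = poly_act A p v"
proof -
  have "poly_act A p v = poly_act A (p div f * f + p mod f) v" by simp
  also have "\<dots> = poly_act A (p div f) (poly_act A f v) + poly_act A (p mod f) v"
    using assms by (simp only: poly_act_add poly_act_mult)
  finally show ?thesis using assms by (simp add: poly_act_zero_vec)
qed

text \<open>Cyclicity is expressed as injectivity of p \<mapsto> p(A) v below degree n rather than
  as v generating the space. The two agree by dimension, and injectivity is what the Krylov matrix
  reflects directly.\<close>

definition cyclic_vec :: "'a::comm_ring_1 mat \<Rightarrow> 'a Matrix.vec \<Rightarrow> bool" where
  "cyclic_vec A v \<longleftrightarrow> (\<forall>p\<in>polys_below (dim_row A). poly_act A p v = 0\<^sub>v (dim_row A) \<longrightarrow> p = 0)"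

lemma cyclic_vecD:
  assumes "cyclic_vec A v" "A \<in> carrier_mat n n" "p \<in> polys_below n" "poly_act A p v = 0\<^sub>v n"
  shows "p = 0"
  using assms(1,3,4) carrier_matD(1)[OF assms(2)] unfolding cyclic_vec_def by blast

text \<open>Both sides have q^n elements, so the injectivity built into \<open>cyclic_vec\<close>
  already yields surjectivity.\<close>

lemma bij_betw_poly_act:
  fixes A :: "'a::{field,finite} mat"
  assumes "A \<in> carrier_mat n n" "v \<in> carrier_vec n" "cyclic_vec A v"
  shows "bij_betw (\<lambda>p. poly_act A p v) (polys_below n) (carrier_vec n)"
proof -
  have inj: "inj_on (\<lambda>p. poly_act A p v) (polys_below n)"
  proof (rule inj_onI)
    fix p r assume pr: "p \<in> polys_below n" "r \<in> polys_below n" "poly_act A p v = poly_act A r v"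
    then have "poly_act A (p - r) v = 0\<^sub>v n" using assms by (simp add: poly_act_diff)
    then show "p = r" using cyclic_vecD[OF assms(3,1) polys_below_diff[OF pr(1,2)]] by simp
  qed
  have "(\<lambda>p. poly_act A p v) ` polys_below n \<subseteq> carrier_vec n" using assms by auto
  moreover have "card ((\<lambda>p. poly_act A p v) ` polys_below n) = card (carrier_vec n :: 'a Matrix.vec set)"
    by (simp add: card_image[OF inj] card_polys_below card_carrier_vec)
  ultimately have "(\<lambda>p. poly_act A p v) ` polys_below n = carrier_vec n"
    by (intro card_subset_eq finite_carrier_vec)
  then show ?thesis using inj by (simp add: bij_betw_def)
qed

text \<open>Division by f leaves a remainder of degree below n with the same action on v, and such a
  remainder kills a cyclic vector only if it is 0. Thus the annihilator of v is the ideal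
  (f).\<close>

lemma poly_act_eq_0_iff_dvd:
  fixes A :: "'a::field mat"
  assumes A: "A \<in> carrier_mat n n" and v: "v \<in> carrier_vec n" "cyclic_vec A v"
    and f: "f \<noteq> 0" "Polynomial.degree f = n" "poly_act A f v = 0\<^sub>v n"
  shows "poly_act A p v = 0\<^sub>v n \<longleftrightarrow> f dvd p"
proof -
  have eq: "poly_act A p v = poly_act A (p mod f) v" using poly_act_mod[OF A v(1) f(3)] by simp
  have "p mod f = 0" if "poly_act A (p mod f) v = 0\<^sub>v n"
    using cyclic_vecD[OF v(2) A _ that] mod_in_polys_below[OF f(1), of p] f(2) by simp
  then show ?thesis using eq v(1) by (metis dvd_eq_mod_eq_0 poly_act_0)
qed

text \<open>For monic f these are the matrices whose module is F[z]/(f), that is, the cyclic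
  matrices with characteristic polynomial f.\<close>

definition cyclic_mats :: "'a::comm_ring_1 poly \<Rightarrow> 'a mat set" where
  "cyclic_mats f = {A \<in> carrier_mat (Polynomial.degree f) (Polynomial.degree f).
     \<exists>v\<in>carrier_vec (Polynomial.degree f). cyclic_vec A v \<and> poly_act A f v = 0\<^sub>v (Polynomial.degree f)}"

text \<open>Every vector is p(A) v for the given cyclic vector v, and polynomials in A
  commute.\<close>

lemma cyclic_mats_annihilates:
  fixes A :: "'a::{field,finite} mat"
  assumes "A \<in> cyclic_mats f" "w \<in> carrier_vec (Polynomial.degree f)"
  shows "poly_act A f w = 0\<^sub>v (Polynomial.degree f)"
proof -
  let ?n = "Polynomial.degree f"
  obtain v where A: "A \<in> carrier_mat ?n ?n" and v: "v \<in> carrier_vec ?n" "cyclic_vec A v" "poly_act A f v = 0\<^sub>v ?n"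
    using assms(1) by (auto simp: cyclic_mats_def)
  obtain p where "w = poly_act A p v"
    using bij_betw_imp_surj_on[OF bij_betw_poly_act[OF A v(1,2)]] assms(2) by blast
  then show ?thesis using poly_act_commute[OF A v(1), of f p] v(3) A by (simp add: poly_act_zero_vec)
qed

text \<open>Both polynomials kill the cyclic vector that comes with g. Being monic of equal degree,
  they differ by a polynomial of smaller degree, and this kills a cyclic vector only if it is
  0.\<close>

lemma cyclic_mats_disjoint:
  fixes A :: "'a::{field,finite} mat"
  assumes "A \<in> cyclic_mats f" "A \<in> cyclic_mats g" "Polynomial.degree f = Polynomial.degree g"
    "Polynomial.lead_coeff f = 1" "Polynomial.lead_coeff g = 1"
  shows "f = g"
proof -
  let ?n = "Polynomial.degree g"
  obtain w where A: "A \<in> carrier_mat ?n ?n" and w: "w \<in> carrier_vec ?n" "cyclic_vec A w" "poly_act A g w = 0\<^sub>v ?n"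
    using assms(2) by (auto simp: cyclic_mats_def)
  have "poly_act A f w = 0\<^sub>v ?n" using cyclic_mats_annihilates[OF assms(1), of w] w(1) assms(3) by simp
  then have "poly_act A (f - g) w = 0\<^sub>v ?n" using A w by (simp add: poly_act_diff)
  moreover have "Polynomial.coeff (f - g) i = 0" if "i \<ge> ?n" for i
    using that assms(3-5) by (cases "i = ?n") (simp_all add: coeff_eq_0)
  then have "f - g \<in> polys_below ?n" by (simp add: polys_below_def)
  ultimately have "f - g = 0" using cyclic_vecD[OF w(2) A] by blast
  then show ?thesis by simp
qed

section \<open>Krylov and companion matrices\<close>

definition krylov :: "'a::comm_ring_1 mat \<Rightarrow> 'a Matrix.vec \<Rightarrow> 'a mat" where
  "krylov A v = mat (dim_row A) (dim_row A) (\<lambda>(i, j). poly_act A (Polynomial.monom 1 j) v $ i)"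

text \<open>For monic f, the matrix of multiplication by z on F[z]/(f) in the basis 1, z, ...,
  z^(n-1): ones below the diagonal, and the reduction of z^n in the last column.\<close>

definition companion :: "'a::comm_ring_1 poly \<Rightarrow> 'a mat" where
  "companion f = mat (Polynomial.degree f) (Polynomial.degree f)
     (\<lambda>(i, j). if Suc j < Polynomial.degree f then (if i = Suc j then 1 else 0) else - Polynomial.coeff f i)"

lemma krylov_carrier [simp]: "A \<in> carrier_mat n n \<Longrightarrow> krylov A v \<in> carrier_mat n n"
  by (simp add: krylov_def)

lemma companion_carrier [simp]: "companion f \<in> carrier_mat (Polynomial.degree f) (Polynomial.degree f)"
  by (simp add: companion_def)

lemma krylov_mult_vec:
  assumes "A \<in> carrier_mat n n" "v \<in> carrier_vec n" "p \<in> polys_below n"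
  shows "krylov A v *\<^sub>v vec n (Polynomial.coeff p) = poly_act A p v"
proof (rule eq_vecI)
  fix i assume "i < dim_vec (poly_act A p v)"
  then have "i < n" using assms by (simp add: dim_poly_act)
  then show "(krylov A v *\<^sub>v vec n (Polynomial.coeff p)) $ i = poly_act A p v $ i"
    using assms by (simp add: poly_act_index[OF assms] krylov_def scalar_prod_def mult.commute atLeast0LessThan)
qed (use assms in \<open>simp add: krylov_def dim_poly_act\<close>)

lemma krylov_injective_iff:
  fixes A :: "'a::field mat"
  assumes A: "A \<in> carrier_mat n n" and v: "v \<in> carrier_vec n"
  shows "krylov A v \<in> injective_mats n n \<longleftrightarrow> cyclic_vec A v"
proof
  assume inj: "krylov A v \<in> injective_mats n n"
  show "cyclic_vec A v" unfolding cyclic_vec_def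
  proof (intro ballI impI)
    fix p assume p: "p \<in> polys_below (dim_row A)" "poly_act A p v = 0\<^sub>v (dim_row A)"
    then have "krylov A v *\<^sub>v vec n (Polynomial.coeff p) = 0\<^sub>v n" using krylov_mult_vec[OF A v, of p] A by simp
    then have eq: "vec n (Polynomial.coeff p) = 0\<^sub>v n" using inj by (simp add: injective_mats_def)
    have "Polynomial.coeff p i = 0" if "i < n" for i
      using that arg_cong[OF eq, of "\<lambda>x. vec_index x i"] by simp
    then show "p = 0" using p A by (intro poly_eqI) (auto simp: polys_below_def not_less[symmetric])
  qed
next
  assume cyc: "cyclic_vec A v"
  have "x = 0\<^sub>v n" if x: "x \<in> carrier_vec n" "krylov A v *\<^sub>v x = 0\<^sub>v n" for x
  proof -
    let ?p = "\<Sum>j<n. Polynomial.monom (vec_index x j) j"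
    have coeff: "Polynomial.coeff ?p i = (if i < n then vec_index x i else 0)" for i by (simp add: coeff_sum)
    then have p: "?p \<in> polys_below n" by (simp add: polys_below_def)
    have "vec n (Polynomial.coeff ?p) = x" using x(1) by (intro eq_vecI) (simp_all add: coeff)
    then have "?p = 0" using krylov_mult_vec[OF A v p] x(2) cyclic_vecD[OF cyc A p] by simp
    then show ?thesis using x(1) coeff by (intro eq_vecI) (metis carrier_vecD coeff_0 index_zero_vec(1,2), simp)
  qed
  then show "krylov A v \<in> injective_mats n n" using A by (simp add: injective_mats_def)
qed

lemma mult_companion_index:
  fixes P :: "'a::comm_ring_1 mat"
  assumes "P \<in> carrier_mat k n" "Polynomial.degree f = n" "i < k" "j < n"
  shows "(P * companion f) $$ (i, j) =
    (if Suc j < n then P $$ (i, Suc j) else - (\<Sum>l<n. Polynomial.coeff f l * P $$ (i, l)))"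
proof -
  have "(P * companion f) $$ (i, j) = (\<Sum>l<n. P $$ (i, l) * companion f $$ (l, j))"
    using assms(3,4) carrier_matD[OF assms(1)] carrier_matD[OF companion_carrier[of f], unfolded assms(2)]
    by (simp add: scalar_prod_def atLeast0LessThan)
  also have "\<dots> = (if Suc j < n then P $$ (i, Suc j) else - (\<Sum>l<n. Polynomial.coeff f l * P $$ (i, l)))"
  proof (cases "Suc j < n")
    case True
    have "(\<Sum>l<n. P $$ (i, l) * companion f $$ (l, j)) = (\<Sum>l<n. if l = Suc j then P $$ (i, l) else 0)"
      using True assms(2,4) by (intro sum.cong) (auto simp: companion_def)
    also have "\<dots> = P $$ (i, Suc j)" using True by simp
    finally show ?thesis using True by simp
  next
    case False
    then show ?thesis using assms(2,4) by (simp add: companion_def sum_negf[symmetric] mult.commute)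
  qed
  finally show ?thesis .
qed

text \<open>f - z^n has degree below n. The term f(A) v is kept because one application starts from
  its vanishing and another one concludes it.\<close>

lemma poly_act_monom_eq_diff:
  assumes A: "A \<in> carrier_mat n n" "v \<in> carrier_vec n"
    and f: "Polynomial.lead_coeff f = 1" "Polynomial.degree f = n" and i: "i < n"
  shows "poly_act A (Polynomial.monom 1 n) v $ i = poly_act A f v $ i
    - (\<Sum>l<n. Polynomial.coeff f l * (poly_act A (Polynomial.monom 1 l) v $ i))"
proof -
  have coeff: "Polynomial.coeff (f - Polynomial.monom 1 n) l = (if l < n then Polynomial.coeff f l else 0)" for l
    using f by (cases "l < n"; cases "l = n") (auto simp: coeff_eq_0)
  then have "f - Polynomial.monom 1 n \<in> polys_below n" by (simp add: polys_below_def)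
  from poly_act_index[OF A this i] show ?thesis
    using A i by (simp add: poly_act_diff dim_poly_act coeff algebra_simps)
qed

text \<open>A carries column j of the Krylov matrix to column j + 1; for the last column, f(A) v = 0
  rewrites A^n v through lower powers.\<close>

lemma mult_krylov:
  assumes A: "A \<in> carrier_mat n n" and v: "v \<in> carrier_vec n"
    and f: "Polynomial.lead_coeff f = 1" "Polynomial.degree f = n" "poly_act A f v = 0\<^sub>v n"
  shows "A * krylov A v = krylov A v * companion f"
proof (rule eq_matI)
  have K: "krylov A v \<in> carrier_mat n n" using A by simp
  have C: "companion f \<in> carrier_mat n n" using f by auto
  fix i j assume "i < dim_row (krylov A v * companion f)" "j < dim_col (krylov A v * companion f)"
  then have ij: "i < n" "j < n" using K C by auto
  have "(A * krylov A v) $$ (i, j) = (A *\<^sub>v col (krylov A v) j) $ i" using ij A carrier_matD[OF K] by simp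
  also have "col (krylov A v) j = poly_act A (Polynomial.monom 1 j) v"
    using ij A v by (intro eq_vecI) (simp_all add: krylov_def dim_poly_act)
  also have "A *\<^sub>v \<dots> = poly_act A (Polynomial.monom 1 (Suc j)) v" using A v by (simp add: poly_act_monom_Suc)
  finally have L: "(A * krylov A v) $$ (i, j) = poly_act A (Polynomial.monom 1 (Suc j)) v $ i" .
  show "(A * krylov A v) $$ (i, j) = (krylov A v * companion f) $$ (i, j)"
  proof (cases "Suc j < n")
    case True
    then show ?thesis unfolding L mult_companion_index[OF K f(2) ij] using ij A by (simp add: krylov_def)
  next
    case False
    then have j: "Suc j = n" using ij by simp
    show ?thesis unfolding L mult_companion_index[OF K f(2) ij] j poly_act_monom_eq_diff[OF A v f(1,2) ij(1)]
      using ij A f(3) by (simp add: krylov_def)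
  qed
qed (use f(2) carrier_matD[OF A] in \<open>simp_all add: krylov_def companion_def\<close>)

lemma injective_mats_inverse:
  fixes P :: "'a::field mat"
  assumes "P \<in> injective_mats n n"
  obtains Q where "Q \<in> carrier_mat n n" "P * Q = 1\<^sub>m n" "Q * P = 1\<^sub>m n"
proof -
  have P: "P \<in> carrier_mat n n" using assms by (simp add: injective_mats_def)
  then have "Determinant.det P \<noteq> 0"
    using assms by (auto simp: det_0_iff_vec_prod_zero_field[OF P] injective_mats_def)
  from det_non_zero_imp_unit[OF P this, of "()"]
  show ?thesis using that by (auto simp: Units_def ring_mat_def)
qed

subsection \<open>Counting matrices with a cyclic vector\<close>

lemma krylov_col_0:
  assumes "A \<in> carrier_mat n n" "v \<in> carrier_vec n" "n > 0"
  shows "col (krylov A v) 0 = v"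
proof -
  have "poly_act A (Polynomial.monom 1 0) v = v" using poly_act_1[OF assms(1,2)] by (simp add: one_pCons monom_0)
  then show ?thesis using assms by (intro eq_vecI) (simp_all add: krylov_def)
qed

text \<open>Converse of \<open>mult_krylov\<close>. Comparing columns in A P = P C, with C the
  companion matrix, shows that column j + 1 is A times column j, so P is the Krylov matrix of its
  first column; the last column then says that f kills it. The hypothesis \<open>n > 0\<close>
  provides that first column.\<close>

lemma krylov_eqI:
  fixes A :: "'a::comm_ring_1 mat"
  assumes A: "A \<in> carrier_mat n n" and P: "P \<in> carrier_mat n n" and n: "n > 0"
    and f: "Polynomial.lead_coeff f = 1" "Polynomial.degree f = n" and eq: "A * P = P * companion f"
  shows "krylov A (col P 0) = P" "poly_act A f (col P 0) = 0\<^sub>v n"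
proof -
  let ?v = "col P 0"
  have v: "?v \<in> carrier_vec n" using P by auto
  have AP: "(A *\<^sub>v col P j) $ i = (if Suc j < n then P $$ (i, Suc j) else - (\<Sum>l<n. Polynomial.coeff f l * P $$ (i, l)))"
    if "i < n" "j < n" for i j
  proof -
    have "(A *\<^sub>v col P j) $ i = (A * P) $$ (i, j)" using that A P by simp
    then show ?thesis unfolding eq mult_companion_index[OF P f(2) that] .
  qed
  have col: "poly_act A (Polynomial.monom 1 j) ?v = col P j" if "j < n" for j
    using that
  proof (induction j)
    case 0
    then show ?case using poly_act_1[OF A v] by (simp add: one_pCons monom_0)
  next
    case (Suc j)
    then have "poly_act A (Polynomial.monom 1 (Suc j)) ?v = A *\<^sub>v col P j"
      using poly_act_monom_Suc[OF A v] by simp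
    then show ?case using Suc.prems AP P A by (intro eq_vecI) auto
  qed
  show "krylov A ?v = P" using A P col by (intro eq_matI) (auto simp: krylov_def)
  show "poly_act A f ?v = 0\<^sub>v n"
  proof (rule eq_vecI)
    fix i assume "i < dim_vec (0\<^sub>v n)"
    then have i: "i < n" by simp
    obtain m where m: "n = Suc m" using n by (cases n) auto
    have "poly_act A (Polynomial.monom 1 n) ?v = A *\<^sub>v col P m"
      unfolding m poly_act_monom_Suc[OF A v] using col[of m] m by simp
    then have "poly_act A (Polynomial.monom 1 n) ?v $ i = - (\<Sum>l<n. Polynomial.coeff f l * P $$ (i, l))"
      using AP[of i m] i m by simp
    moreover have "(\<Sum>l<n. Polynomial.coeff f l * (poly_act A (Polynomial.monom 1 l) ?v $ i)) = (\<Sum>l<n. Polynomial.coeff f l * P $$ (i, l))"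
      using i P col by (intro sum.cong) auto
    ultimately show "poly_act A f ?v $ i = 0\<^sub>v n $ i"
      using poly_act_monom_eq_diff[OF A v f i] i by simp
  qed (use A v in \<open>simp add: dim_poly_act\<close>)
qed

text \<open>The Krylov matrix K determines the pair: v is its first column and A = K C K^(-1) with C
  the companion matrix. Hence the number of pairs is the same for every monic f of degree n.\<close>

lemma card_cyclic_pairs:
  fixes f :: "'a::field poly"
  assumes f: "Polynomial.lead_coeff f = 1" "Polynomial.degree f = n" and n: "n > 0"
  shows "card (SIGMA A : carrier_mat n n. {v \<in> carrier_vec n. cyclic_vec A v \<and> poly_act A f v = 0\<^sub>v n}) =
    card (injective_mats n n :: 'a mat set)"
proof -
  let ?D = "SIGMA A : carrier_mat n n. {v \<in> carrier_vec n. cyclic_vec A v \<and> poly_act A f v = 0\<^sub>v n}"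
  have C: "companion f \<in> carrier_mat n n" using f by auto
  have "bij_betw (\<lambda>(A, v). krylov A v) ?D (injective_mats n n)"
  proof (rule bij_betwI')
    fix x y assume "x \<in> ?D" "y \<in> ?D"
    then obtain A v B w where xy: "x = (A, v)" "y = (B, w)"
      and A: "A \<in> carrier_mat n n" "v \<in> carrier_vec n" "cyclic_vec A v" "poly_act A f v = 0\<^sub>v n"
      and B: "B \<in> carrier_mat n n" "w \<in> carrier_vec n" "poly_act B f w = 0\<^sub>v n"
      by auto
    have "A = B \<and> v = w" if eq: "krylov A v = krylov B w"
    proof
      let ?K = "krylov A v"
      have K: "?K \<in> carrier_mat n n" using A(1) by simp
      have inj: "?K \<in> injective_mats n n" using krylov_injective_iff A by blast
      obtain Q where Q: "Q \<in> carrier_mat n n" "?K * Q = 1\<^sub>m n" using injective_mats_inverse[OF inj] by blast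
      have "A * ?K = B * ?K"
        using mult_krylov[OF A(1,2) f A(4)] mult_krylov[OF B(1,2) f B(3)] eq by simp
      then have "A * (?K * Q) = B * (?K * Q)"
        by (simp only: assoc_mult_mat[OF A(1) K Q(1), symmetric] assoc_mult_mat[OF B(1) K Q(1), symmetric])
      then show "A = B" using A(1) B(1) Q(2) by simp
      show "v = w" using krylov_col_0[OF A(1,2) n] krylov_col_0[OF B(1,2) n] eq by simp
    qed
    then show "((\<lambda>(A, v). krylov A v) x = (\<lambda>(A, v). krylov A v) y) = (x = y)" using xy by auto
  next
    fix x assume "x \<in> ?D"
    then show "(\<lambda>(A, v). krylov A v) x \<in> injective_mats n n" using krylov_injective_iff by auto
  next
    fix P :: "'a mat" assume inj: "P \<in> injective_mats n n"
    then have P: "P \<in> carrier_mat n n" by (simp add: injective_mats_def)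
    obtain Q where Q: "Q \<in> carrier_mat n n" "P * Q = 1\<^sub>m n" "Q * P = 1\<^sub>m n"
      using injective_mats_inverse[OF inj] by blast
    define A where "A = P * companion f * Q"
    have A: "A \<in> carrier_mat n n" unfolding A_def using P C Q(1) by (meson mult_carrier_mat)
    have v: "col P 0 \<in> carrier_vec n" using P by auto
    have "A * P = (P * companion f) * (Q * P)"
      unfolding A_def by (rule assoc_mult_mat[OF mult_carrier_mat[OF P C] Q(1) P])
    also have "\<dots> = P * companion f" unfolding Q(3) by (rule right_mult_one_mat[OF mult_carrier_mat[OF P C]])
    finally have eq: "A * P = P * companion f" .
    note K = krylov_eqI[OF A P n f eq]
    have "cyclic_vec A (col P 0)" using krylov_injective_iff[OF A v] K(1) inj by simp
    then have "(A, col P 0) \<in> ?D" using A v K(2) by simp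
    then show "\<exists>x\<in>?D. P = (\<lambda>(A, v). krylov A v) x" using K(1) by (intro bexI[of _ "(A, col P 0)"]) simp_all
  qed
  then show ?thesis by (rule bij_betw_same_card)
qed

lemma irreducible_setsD:
  assumes "S \<in> irreducible_sets n"
  shows "finite S" "S \<subseteq> monic_irreducibles" "sum Polynomial.degree S = n"
    "Polynomial.lead_coeff (\<Prod>S) = 1" "Polynomial.degree (\<Prod>S) = n" "\<Prod>S \<noteq> 0"
proof -
  show S: "finite S" "S \<subseteq> monic_irreducibles" "sum Polynomial.degree S = n"
    using assms by (simp_all add: irreducible_sets_def)
  show "Polynomial.lead_coeff (\<Prod>S) = 1" using S(2) by (rule lead_coeff_prod_monic_irreducibles)
  then show "\<Prod>S \<noteq> 0" by force
  show "Polynomial.degree (\<Prod>S) = n" using degree_prod_monic_irreducibles[OF S(2)] S(3) by simp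
qed

lemma prod_irreducible_set_dvd_imp_0:
  fixes p :: "'a::field poly"
  assumes "S \<in> irreducible_sets n" "\<Prod>S dvd p" "p \<in> polys_below n"
  shows "p = 0"
  using dvd_imp_degree_le[OF assms(2)] irreducible_setsD(5)[OF assms(1)] assms(3)
  unfolding polys_below_iff_degree by linarith

text \<open>Put f = \<open>\<Prod>S\<close>. The vector g(A) v corresponds to g in F[z]/(f), which
  generates iff it is a unit. If \<phi> divides g, then f/\<phi> has degree below n and kills g(A)
  v; otherwise, if f divides p g, each \<phi> and hence f divides p.\<close>

lemma cyclic_vec_poly_act_iff:
  fixes A :: "'a::{field,finite} mat"
  assumes S: "S \<in> irreducible_sets n" and A: "A \<in> carrier_mat n n"
    and v: "v \<in> carrier_vec n" "cyclic_vec A v" "poly_act A (\<Prod>S) v = 0\<^sub>v n"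
  shows "cyclic_vec A (poly_act A g v) \<longleftrightarrow> (\<forall>\<phi>\<in>S. \<not> \<phi> dvd g)"
proof -
  note S' = irreducible_setsD[OF S]
  have act: "poly_act A p (poly_act A g v) = 0\<^sub>v n \<longleftrightarrow> \<Prod>S dvd p * g" for p
    using poly_act_eq_0_iff_dvd[OF A v(1,2) S'(6,5) v(3), of "p * g"] poly_act_mult[OF A v(1)] by simp
  show ?thesis
  proof
    assume cyc: "cyclic_vec A (poly_act A g v)"
    show "\<forall>\<phi>\<in>S. \<not> \<phi> dvd g"
    proof (intro ballI notI)
      fix \<phi> assume \<phi>: "\<phi> \<in> S" "\<phi> dvd g"
      let ?h = "\<Prod>(S - {\<phi>})"
      have \<phi>': "\<phi> \<noteq> 0" "Polynomial.degree \<phi> > 0" using \<phi> S'(2) monic_irreduciblesD by auto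
      have f: "\<Prod>S = \<phi> * ?h" using prod.remove[OF S'(1) \<phi>(1)] .
      then have h0: "?h \<noteq> 0" using S'(6) by auto
      then have "Polynomial.degree \<phi> + Polynomial.degree ?h = n" using f S'(5) \<phi>'(1) by (simp add: degree_mult_eq)
      then have "?h \<in> polys_below n" using \<phi>'(2) by (simp add: polys_below_iff_degree)
      moreover have "\<Prod>S dvd ?h * g" unfolding f using \<phi>(2) by (simp add: mult.commute mult_dvd_mono)
      ultimately show False using act[of ?h] cyclic_vecD[OF cyc A] h0 by blast
    qed
  next
    assume ndvd: "\<forall>\<phi>\<in>S. \<not> \<phi> dvd g"
    show "cyclic_vec A (poly_act A g v)" unfolding cyclic_vec_def
    proof (intro ballI impI)
      fix p assume p: "p \<in> polys_below (dim_row A)" "poly_act A p (poly_act A g v) = 0\<^sub>v (dim_row A)"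
      then have dvd: "\<Prod>S dvd p * g" using act A by simp
      have "\<phi> dvd p" if "\<phi> \<in> S" for \<phi>
      proof -
        have "prime_elem \<phi>" using that S'(2) monic_irreduciblesD(4) by auto
        moreover have "\<phi> dvd p * g" using dvd_trans[OF dvd_prod_eqI[OF S'(1) that refl] dvd] .
        ultimately show ?thesis using ndvd that by (simp add: prime_elem_dvd_mult_iff)
      qed
      then have "\<Prod>S dvd p" using prod_monic_irreducibles_dvd S'(1,2) by blast
      then show "p = 0" using prod_irreducible_set_dvd_imp_0[OF S] p(1) A by simp
    qed
  qed
qed

text \<open>Once one cyclic vector v is fixed, every vector is g(A) v for a unique g of degree below
  n, and the cyclic ones come from the g prime to all members of S.\<close>

lemma card_cyclic_vecs:
  fixes A :: "'a::{field,finite} mat"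
  assumes S: "S \<in> irreducible_sets n" and A: "A \<in> cyclic_mats (\<Prod>S)"
  shows "card {v \<in> carrier_vec n. cyclic_vec A v \<and> poly_act A (\<Prod>S) v = 0\<^sub>v n} =
    (\<Prod>\<phi>\<in>S. CARD('a) ^ Polynomial.degree \<phi> - 1)"
proof -
  note S' = irreducible_setsD[OF S]
  obtain v where A': "A \<in> carrier_mat n n" and v: "v \<in> carrier_vec n" "cyclic_vec A v" "poly_act A (\<Prod>S) v = 0\<^sub>v n"
    using A S'(5) by (auto simp: cyclic_mats_def)
  let ?G = "{g \<in> polys_below n. \<forall>\<phi>\<in>S. \<not> \<phi> dvd g}"
  note bij = bij_betw_poly_act[OF A' v(1,2)]
  have "{w \<in> carrier_vec n. cyclic_vec A w \<and> poly_act A (\<Prod>S) w = 0\<^sub>v n} = (\<lambda>g. poly_act A g v) ` ?G"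
  proof (intro equalityI subsetI)
    fix w assume w: "w \<in> {w \<in> carrier_vec n. cyclic_vec A w \<and> poly_act A (\<Prod>S) w = 0\<^sub>v n}"
    then have "w \<in> (\<lambda>g. poly_act A g v) ` polys_below n" using bij_betw_imp_surj_on[OF bij] by simp
    then obtain g where "g \<in> polys_below n" "w = poly_act A g v" by (elim imageE)
    then show "w \<in> (\<lambda>g. poly_act A g v) ` ?G" using w cyclic_vec_poly_act_iff[OF S A' v, of g] by simp
  next
    fix w assume "w \<in> (\<lambda>g. poly_act A g v) ` ?G"
    then obtain g where g: "g \<in> ?G" "w = poly_act A g v" by (elim imageE)
    then have "cyclic_vec A w" using cyclic_vec_poly_act_iff[OF S A' v, of g] by simp
    moreover have "w \<in> carrier_vec n" using g A' v by simp
    ultimately show "w \<in> {w \<in> carrier_vec n. cyclic_vec A w \<and> poly_act A (\<Prod>S) w = 0\<^sub>v n}"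
      using cyclic_mats_annihilates[OF A, of w] S'(5) by simp
  qed
  moreover have "inj_on (\<lambda>g. poly_act A g v) ?G"
    using bij_betw_imp_inj_on[OF bij] by (rule inj_on_subset) auto
  ultimately have "card {w \<in> carrier_vec n. cyclic_vec A w \<and> poly_act A (\<Prod>S) w = 0\<^sub>v n} = card ?G"
    by (simp add: card_image)
  then show ?thesis using card_units_mod_prod[OF S'(1,2)] S'(3) by simp
qed

lemma card_cyclic_mats:
  fixes S :: "'a::{field,finite} poly set"
  assumes S: "S \<in> irreducible_sets n" and n: "n > 0"
  shows "real (card (cyclic_mats (\<Prod>S))) = real (card (injective_mats n n :: 'a mat set)) *
    (\<Prod>\<phi>\<in>S. 1 / (real CARD('a) ^ Polynomial.degree \<phi> - 1))"
proof -
  note S' = irreducible_setsD[OF S]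
  let ?X = "cyclic_mats (\<Prod>S)" and ?V = "\<lambda>A. {v \<in> carrier_vec n. cyclic_vec A v \<and> poly_act A (\<Prod>S) v = 0\<^sub>v n}"
  let ?w = "\<Prod>\<phi>\<in>S. CARD('a) ^ Polynomial.degree \<phi> - 1"
  have sub: "?X \<subseteq> carrier_mat n n" using S'(5) by (auto simp: cyclic_mats_def)
  have "card (injective_mats n n :: 'a mat set) = card (SIGMA A : carrier_mat n n. ?V A)"
    using card_cyclic_pairs[OF S'(4,5) n] by simp
  \<comment> \<open>Fibres over matrices outside \<open>?X\<close> are empty, and over
    \<open>?X\<close> they all have the same size \<open>?w\<close>.\<close>
  also have "(SIGMA A : carrier_mat n n. ?V A) = (SIGMA A : ?X. ?V A)"
    unfolding cyclic_mats_def S'(5) by blast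
  also have "card \<dots> = (\<Sum>A\<in>?X. card (?V A))"
    by (rule card_SigmaI) (use finite_subset[OF sub finite_carrier_mat] finite_carrier_vec[of n] in auto)
  also have "\<dots> = card ?X * ?w" using card_cyclic_vecs[OF S] by simp
  finally have eq: "real (card (injective_mats n n :: 'a mat set)) = real (card ?X) * real ?w" by simp
  have q: "CARD('a) > 1" using card_mono[of UNIV "{0, 1::'a}"] by simp
  have pos: "real CARD('a) ^ Polynomial.degree \<phi> - 1 > 0" if "\<phi> \<in> S" for \<phi>
  proof -
    have "Polynomial.degree \<phi> > 0" using that S'(2) monic_irreduciblesD(3) by auto
    then show ?thesis using q by (simp add: one_less_power)
  qed
  have "real ?w = (\<Prod>\<phi>\<in>S. real CARD('a) ^ Polynomial.degree \<phi> - 1)"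
    unfolding of_nat_prod using q by (intro prod.cong) (simp_all add: of_nat_diff)
  moreover have "(\<Prod>\<phi>\<in>S. real CARD('a) ^ Polynomial.degree \<phi> - 1) > 0" using pos by (rule prod_pos)
  ultimately show ?thesis unfolding eq by (simp add: prod_dividef)
qed

subsection \<open>Diagonalizability\<close>

lemma poly_act_map_to_ac:
  fixes A :: "'a::field mat"
  assumes "A \<in> carrier_mat n n" "v \<in> carrier_vec n"
  shows "poly_act (map_mat to_ac A) (map_poly to_ac p) (map_vec to_ac v) = map_vec to_ac (poly_act A p v)"
proof (induction p)
  case 0
  then show ?case using assms by (simp add: poly_act_0[of _ n] to_ac.vec_hom_zero)
next
  case (pCons a p)
  have "map_vec to_ac (A *\<^sub>v poly_act A p v) = map_mat to_ac A *\<^sub>v map_vec to_ac (poly_act A p v)"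
    using assms by (intro to_ac.mult_mat_vec_hom[of _ n n]) auto
  moreover have "map_vec to_ac (a \<cdot>\<^sub>v v + w) = to_ac a \<cdot>\<^sub>v map_vec to_ac v + map_vec to_ac w"
    if "w \<in> carrier_vec n" for w
    using that assms(2) by (intro eq_vecI) auto
  ultimately have "map_vec to_ac (poly_act A (pCons a p) v)
      = to_ac a \<cdot>\<^sub>v map_vec to_ac v + map_mat to_ac A *\<^sub>v map_vec to_ac (poly_act A p v)"
    using assms by (simp add: poly_act_pCons)
  then show ?case using assms pCons
    by (simp add: to_ac.map_poly_pCons_hom poly_act_pCons[of _ n])
qed

lemma poly_act_diagonal:
  fixes D :: "'a::comm_ring_1 mat"
  assumes D: "D \<in> carrier_mat n n" "diagonal_mat D" and v: "v \<in> carrier_vec n"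
  shows "poly_act D p v = vec n (\<lambda>i. poly p (D $$ (i, i)) * vec_index v i)"
proof (induction p)
  case 0
  then show ?case using v by (auto intro!: eq_vecI)
next
  case (pCons a p)
  have mult: "(D *\<^sub>v w) $ i = D $$ (i, i) * w $ i" if "w \<in> carrier_vec n" "i < n" for w i
  proof -
    have "(D *\<^sub>v w) $ i = (\<Sum>j<n. D $$ (i, j) * w $ j)"
      using that D by (simp add: scalar_prod_def atLeast0LessThan)
    also have "\<dots> = (\<Sum>j<n. if j = i then D $$ (i, i) * w $ i else 0)"
      using that D by (intro sum.cong) (auto simp: diagonal_mat_def)
    finally have "(D *\<^sub>v w) $ i = (\<Sum>j<n. if j = i then D $$ (i, i) * w $ i else 0)" .
    then show ?thesis using that(2) by simp
  qed
  then show ?case using D v pCons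
    by (intro eq_vecI) (simp_all add: poly_act_pCons[OF D(1) v] algebra_simps)
qed

text \<open>Over the closure A is conjugate to a diagonal matrix, on which r acts coordinatewise by
  scalars, and scalars are not nilpotent unless 0. This is how semisimplicity excludes parts larger
  than 1.\<close>

lemma semisimple_mat_radical:
  fixes A :: "'a::field mat"
  assumes A: "A \<in> carrier_mat n n" and ss: "semisimple_mat A" and v: "v \<in> carrier_vec n"
    and pow: "poly_act A (r ^ k) v = 0\<^sub>v n"
  shows "poly_act A r v = 0\<^sub>v n"
proof -
  let ?A = "map_mat to_ac A" and ?v = "map_vec to_ac v" and ?r = "map_poly to_ac r"
  have A': "?A \<in> carrier_mat n n" and v': "?v \<in> carrier_vec n" using A v by auto
  obtain D where D: "diagonal_mat D" "similar_mat ?A D" using ss by (auto simp: semisimple_mat_def)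
  obtain P Q where "similar_mat_wit ?A D P Q" using D(2) by (auto simp: similar_mat_def)
  note w = similar_mat_witD2[OF A' this]
  have D': "D \<in> carrier_mat n n" and P: "P \<in> carrier_mat n n" and Q: "Q \<in> carrier_mat n n" using w by auto
  let ?w = "Q *\<^sub>v ?v"
  have w': "?w \<in> carrier_vec n" using Q v' by simp
  have v_eq: "P *\<^sub>v ?w = ?v"
    using w(1) P Q v' by (simp add: assoc_mult_mat_vec[symmetric])
  have inter: "?A * P = P * D"
  proof -
    have "?A * P = (P * D) * (Q * P)" unfolding w(3) by (rule assoc_mult_mat[OF mult_carrier_mat[OF P D'] Q P])
    then show ?thesis using w(2) P D' by simp
  qed
  have inter': "Q * ?A = D * Q"
  proof -
    have "Q * ?A = Q * (P * (D * Q))" unfolding w(3) assoc_mult_mat[OF P D' Q] ..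
    also have "\<dots> = (Q * P) * (D * Q)" by (rule assoc_mult_mat[OF Q P mult_carrier_mat[OF D' Q], symmetric])
    finally show ?thesis using w(2) D' Q by simp
  qed
  have "poly_act D (?r ^ k) ?w = Q *\<^sub>v poly_act ?A (map_poly to_ac (r ^ k)) ?v"
    using poly_act_intertwine[OF D' A' Q v' inter'[symmetric], of "map_poly to_ac (r ^ k)"]
    by (simp add: to_ac_poly.hom_power)
  also have "poly_act ?A (map_poly to_ac (r ^ k)) ?v = 0\<^sub>v n"
    unfolding poly_act_map_to_ac[OF A v] pow by (rule to_ac.vec_hom_zero)
  finally have zero: "poly_act D (?r ^ k) ?w = 0\<^sub>v n" using Q by (simp add: mult_mat_zero_vec)
  have "poly_act D ?r ?w = 0\<^sub>v n"
  proof (rule eq_vecI)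
    fix i assume "i < dim_vec (0\<^sub>v n)"
    then have i: "i < n" by simp
    have "poly ?r (D $$ (i, i)) ^ k * ?w $ i = 0"
      using arg_cong[OF zero, of "\<lambda>x. vec_index x i"] i unfolding poly_act_diagonal[OF D' D(1) w'] by simp
    \<comment> \<open>Either the scalar or the coordinate of \<open>?w\<close> is 0; for k = 0 it is
      the coordinate.\<close>
    then have "poly ?r (D $$ (i, i)) * ?w $ i = 0" by auto
    then show "poly_act D ?r ?w $ i = 0\<^sub>v n $ i"
      using i unfolding poly_act_diagonal[OF D' D(1) w'] by simp
  qed (use D' w' in \<open>simp add: dim_poly_act\<close>)
  then have "poly_act ?A ?r ?v = 0\<^sub>v n"
    using poly_act_intertwine[OF A' D' P w' inter, of ?r] P by (simp add: v_eq mult_mat_zero_vec)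
  then have "map_vec to_ac (poly_act A r v) = 0\<^sub>v n" by (simp add: poly_act_map_to_ac[OF A v])
  then show ?thesis by simp
qed

text \<open>The Vandermonde matrix diagonalizes: for a root x, its row (1, x, ..., x^(n-1)) is a
  left eigenvector of \<open>companion F\<close> with eigenvalue x. It is injective because a
  nonzero polynomial of degree below n cannot vanish at n distinct points.\<close>

lemma similar_mat_diagonal_companion:
  fixes F :: "'a::field poly"
  assumes F: "Polynomial.lead_coeff F = 1" "Polynomial.degree F = n"
    and xs: "distinct xs" "length xs = n" "\<And>x. x \<in> set xs \<Longrightarrow> poly F x = 0"
  shows "similar_mat (companion F) (mat n n (\<lambda>(i, j). if i = j then xs ! i else 0))"
proof -
  let ?C = "companion F" and ?D = "mat n n (\<lambda>(i, j). if i = j then xs ! i else 0)"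
  let ?W = "mat n n (\<lambda>(i, j). (xs ! i) ^ j)"
  have C: "?C \<in> carrier_mat n n" using F by auto
  have W: "?W \<in> carrier_mat n n" and D: "?D \<in> carrier_mat n n" by simp_all
  have "?W \<in> injective_mats n n"
    unfolding injective_mats_def
  proof (intro CollectI conjI ballI impI)
    fix c :: "'a Matrix.vec" assume c: "c \<in> carrier_vec n" "?W *\<^sub>v c = 0\<^sub>v n"
    let ?p = "\<Sum>j<n. Polynomial.monom (vec_index c j) j"
    have coeff: "Polynomial.coeff ?p i = (if i < n then vec_index c i else 0)" for i by (simp add: coeff_sum)
    have root: "poly ?p x = 0" if x: "x \<in> set xs" for x
    proof -
      obtain i where i: "i < n" "x = xs ! i" using x xs(2) by (auto simp: in_set_conv_nth)
      have "(?W *\<^sub>v c) $ i = poly ?p x"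
        using i c(1) by (simp add: scalar_prod_def poly_sum poly_monom mult.commute atLeast0LessThan)
      then show ?thesis using c(2) i by simp
    qed
    have "?p = 0"
    proof (rule ccontr)
      assume nz: "?p \<noteq> 0"
      then have "card (set xs) \<le> card {x. poly ?p x = 0}"
        using root by (intro card_mono poly_roots_finite) auto
      also have "\<dots> \<le> Polynomial.degree ?p" using nz by (rule card_poly_roots_bound)
      finally have "n \<le> Polynomial.degree ?p" using xs by (simp add: distinct_card)
      moreover have "?p \<in> polys_below n" by (simp add: polys_below_def coeff)
      ultimately show False using nz unfolding polys_below_iff_degree by linarith
    qed
    then have "vec_index c i = 0" if "i < n" for i using coeff[of i] that by simp
    then show "c = 0\<^sub>v n" using c(1) by (intro eq_vecI) auto
  qed simp
  then obtain Q where Q: "Q \<in> carrier_mat n n" "?W * Q = 1\<^sub>m n" "Q * ?W = 1\<^sub>m n" by (rule injective_mats_inverse)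
  have "?W * ?C = ?D * ?W"
  proof (rule eq_matI)
    fix i j assume "i < dim_row (?D * ?W)" "j < dim_col (?D * ?W)"
    then have ij: "i < n" "j < n" by simp_all
    have "(?D * ?W) $$ (i, j) = (\<Sum>l<n. (if i = l then xs ! i else 0) * (xs ! l) ^ j)"
      using ij by (simp add: scalar_prod_def atLeast0LessThan)
    also have "\<dots> = (\<Sum>l<n. if l = i then xs ! i * (xs ! i) ^ j else 0)"
      by (intro sum.cong) auto
    finally have R: "(?D * ?W) $$ (i, j) = (xs ! i) ^ Suc j" using ij by simp
    have "(\<Sum>l<n. Polynomial.coeff F l * (xs ! i) ^ l) + (xs ! i) ^ n = poly F (xs ! i)"
      using F by (simp add: poly_altdef lessThan_Suc_atMost[symmetric])
    also have "\<dots> = 0" using xs ij by simp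
    finally have "(xs ! i) ^ n = - (\<Sum>l<n. Polynomial.coeff F l * (xs ! i) ^ l)"
      by (simp add: eq_neg_iff_add_eq_0 add.commute)
    then show "(?W * ?C) $$ (i, j) = (?D * ?W) $$ (i, j)"
      unfolding mult_companion_index[OF W F(2) ij] R using ij by (cases "Suc j = n") auto
  qed (use F in \<open>simp_all add: companion_def\<close>)
  then have "Q * (?D * ?W) = (Q * ?W) * ?C" using assoc_mult_mat[OF Q(1) W C] by simp
  also have "\<dots> = ?C" unfolding Q(3) by (rule left_mult_one_mat[OF C])
  finally have C_eq: "?C = Q * ?D * ?W" using assoc_mult_mat[OF Q(1) D W] by simp
  show ?thesis
    by (rule similar_matI[OF _ Q(3,2) C_eq]) (use C D W Q(1) in simp)
qed

text \<open>The Krylov matrix conjugates A to a companion matrix over F. Extension of scalars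
  preserves this and commutes with forming companion matrices; over the closure the distinct roots
  of \<open>\<Prod>S\<close> diagonalize the result.\<close>

lemma semisimple_cyclic_mats:
  fixes A :: "'a::{field,finite} mat"
  assumes S: "S \<in> irreducible_sets n" and A: "A \<in> cyclic_mats (\<Prod>S)"
  shows "semisimple_mat A"
proof -
  note S' = irreducible_setsD[OF S]
  let ?f = "\<Prod>S" and ?F = "map_poly to_ac (\<Prod>S)"
  obtain v where A': "A \<in> carrier_mat n n" and v: "v \<in> carrier_vec n" "cyclic_vec A v" "poly_act A ?f v = 0\<^sub>v n"
    using A S'(5) by (auto simp: cyclic_mats_def)
  let ?K = "krylov A v" and ?C = "companion ?f"
  have K: "?K \<in> carrier_mat n n" using A' by simp
  have C: "?C \<in> carrier_mat n n" using S'(5) by auto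
  have "?K \<in> injective_mats n n" using krylov_injective_iff[OF A' v(1)] v(2) by simp
  then obtain Q where Q: "Q \<in> carrier_mat n n" "?K * Q = 1\<^sub>m n" "Q * ?K = 1\<^sub>m n" by (rule injective_mats_inverse)
  have "?K * ?C * Q = A * (?K * Q)"
    unfolding mult_krylov[OF A' v(1) S'(4,5) v(3), symmetric] by (rule assoc_mult_mat[OF A' K Q(1)])
  then have A_eq: "A = ?K * ?C * Q" using Q(2) A' by simp
  let ?h = "map_mat to_ac :: 'a mat \<Rightarrow> 'a alg_closure mat"
  have sim: "similar_mat (?h A) (?h ?C)"
  proof (rule similar_matI[of _ _ "?h ?K" "?h Q" n])
    show "{?h A, ?h ?C, ?h ?K, ?h Q} \<subseteq> carrier_mat n n" using A' C K Q(1) by simp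
    show "?h ?K * ?h Q = 1\<^sub>m n" "?h Q * ?h ?K = 1\<^sub>m n"
      using to_ac.mat_hom_mult[OF K Q(1)] to_ac.mat_hom_mult[OF Q(1) K] Q(2,3) by (simp_all add: to_ac.mat_hom_one)
    have "?h A = ?h (?K * ?C * Q)" using A_eq by simp
    then show "?h A = ?h ?K * ?h ?C * ?h Q"
      by (simp only: to_ac.mat_hom_mult[OF mult_carrier_mat[OF K C] Q(1)] to_ac.mat_hom_mult[OF K C])
  qed
  have hC: "?h ?C = companion ?F"
    by (intro eq_matI) (auto simp: companion_def)
  obtain xs where xs: "distinct xs" "length xs = n" "\<And>x. x \<in> set xs \<Longrightarrow> poly ?F x = 0"
    using distinct_roots_prod_monic_irreducibles[OF S'(1,2)] S'(5) by auto
  have F: "Polynomial.lead_coeff ?F = 1" "Polynomial.degree ?F = n"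
    using S'(4,5) by simp_all
  have "similar_mat (?h A) (mat n n (\<lambda>(i, j). if i = j then xs ! i else 0))"
    by (rule similar_mat_trans[OF sim[unfolded hC] similar_mat_diagonal_companion[OF F xs]])
  moreover have "diagonal_mat (mat n n (\<lambda>(i, j). if i = j then xs ! i else (0 :: 'a alg_closure)))"
    by (simp add: diagonal_mat_def)
  ultimately show ?thesis unfolding semisimple_mat_def by blast
qed

subsection \<open>Primary decomposition\<close>

text \<open>
  The hypothesis on \<open>summand_index\<close> says that every partition has at most one part, and that it is
  nonempty exactly for the irreducibles in \<open>S\<close>.
\<close>

lemma bij_betw_primary_sum:
  fixes lam :: "'a::{field,finite} poly \<Rightarrow> nat list"
  assumes idx: "summand_index lam = S \<times> {0}" and S: "finite S"
    and m: "\<And>\<phi>. \<phi> \<in> S \<Longrightarrow> summand_modulus lam (\<phi>, 0) = m \<phi> \<and> m \<phi> \<noteq> 0"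
  shows "bij_betw (\<lambda>u i. if i \<in> S \<times> {0} then u (fst i) else 0)
    (PiE S (\<lambda>\<phi>. polys_below (Polynomial.degree (m \<phi>)))) (primary_sum lam)"
proof (rule bij_betw_byWitness[where f' = "\<lambda>F. \<lambda>\<phi>\<in>S. F (\<phi>, 0)"])
  show "\<forall>u\<in>PiE S (\<lambda>\<phi>. polys_below (Polynomial.degree (m \<phi>))).
      (\<lambda>\<phi>\<in>S. (\<lambda>i. if i \<in> S \<times> {0} then u (fst i) else 0) (\<phi>, 0)) = u"
    by (auto simp: PiE_def extensional_def fun_eq_iff)
  show "\<forall>F\<in>primary_sum lam. (\<lambda>i. if i \<in> S \<times> {0} then (\<lambda>\<phi>\<in>S. F (\<phi>, 0)) (fst i) else 0) = F"
    by (auto simp: primary_sum_def idx fun_eq_iff)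
  show "(\<lambda>u i. if i \<in> S \<times> {0} then u (fst i) else 0) ` PiE S (\<lambda>\<phi>. polys_below (Polynomial.degree (m \<phi>)))
      \<subseteq> primary_sum lam"
  proof (rule image_subsetI)
    fix u :: "'a poly \<Rightarrow> 'a poly" assume u: "u \<in> PiE S (\<lambda>\<phi>. polys_below (Polynomial.degree (m \<phi>)))"
    have "finite {i. (if i \<in> S \<times> {0} then u (fst i) else 0) \<noteq> 0}"
      by (rule finite_subset[of _ "S \<times> {0}"]) (use S in auto)
    moreover have "u \<phi> mod m \<phi> = u \<phi>" if "\<phi> \<in> S" for \<phi>
      using u that m[OF that] by (auto simp: mod_eq_self_iff_polys_below PiE_iff)
    ultimately show "(\<lambda>i. if i \<in> S \<times> {0} then u (fst i) else 0) \<in> primary_sum lam"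
      using m unfolding primary_sum_def idx by (intro CollectI conjI) auto
  qed
  show "(\<lambda>F. \<lambda>\<phi>\<in>S. F (\<phi>, 0)) ` primary_sum lam \<subseteq> PiE S (\<lambda>\<phi>. polys_below (Polynomial.degree (m \<phi>)))"
  proof (rule image_subsetI)
    fix F assume F: "F \<in> primary_sum lam"
    have "F (\<phi>, 0) \<in> polys_below (Polynomial.degree (m \<phi>))" if "\<phi> \<in> S" for \<phi>
      using F that m[OF that] mod_eq_self_iff_polys_below[of "m \<phi>" "F (\<phi>, 0)"] by (auto simp: primary_sum_def idx)
    then show "(\<lambda>\<phi>\<in>S. F (\<phi>, 0)) \<in> PiE S (\<lambda>\<phi>. polys_below (Polynomial.degree (m \<phi>)))" by auto
  qed
qed

text \<open>The module is F[z]/(f) with f = \<open>\<Prod>S\<close>, and the Chinese remainder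
  theorem splits it into the fields F[z]/(\<phi>), one part of size 1 for each \<phi> in S. The
  isomorphism sends p(A) v to the residues of p.\<close>

lemma regular_cyclic_mats:
  fixes A :: "'a::{field,finite} mat"
  assumes S: "S \<in> irreducible_sets n" and A: "A \<in> cyclic_mats (\<Prod>S)"
  shows "regular_mat A"
proof -
  note S' = irreducible_setsD[OF S]
  let ?f = "\<Prod>S" and ?z = "[:0, 1:] :: 'a poly"
  obtain v where A': "A \<in> carrier_mat n n" and v: "v \<in> carrier_vec n" "cyclic_vec A v" "poly_act A ?f v = 0\<^sub>v n"
    using A S'(5) by (auto simp: cyclic_mats_def)
  define lam where "lam = (\<lambda>\<phi> :: 'a poly. if \<phi> \<in> S then [1 :: nat] else [])"
  have idx: "summand_index lam = S \<times> {0}"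
    using S'(2) by (auto simp: summand_index_def lam_def split: if_splits)
  have mod: "summand_modulus lam (\<phi>, 0) = \<phi>" if "\<phi> \<in> S" for \<phi>
    using that by (simp add: summand_modulus_def lam_def)
  have nz: "\<phi> \<noteq> 0" if "\<phi> \<in> S" for \<phi> using that S'(2) monic_irreduciblesD(2) by auto
  let ?act = "\<lambda>p. poly_act A p v"
  define R where "R = (\<lambda>p (i :: 'a poly \<times> nat). if i \<in> S \<times> {0} then p mod fst i else (0 :: 'a poly))"
  define h where "h = inv_into (polys_below n) ?act"
  note bij = bij_betw_poly_act[OF A' v(1,2)]
  have bij_h: "bij_betw h (carrier_vec n) (polys_below n)" unfolding h_def using bij by (rule bij_betw_inv_into)
  have act_h: "?act (h w) = w" if "w \<in> carrier_vec n" for w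
    unfolding h_def using that by (rule bij_betw_inv_into_right[OF bij])
  have h_eqI: "h w = p" if "p \<in> polys_below n" "?act p = w" for p w
    unfolding h_def that(2)[symmetric] using that(1) by (rule bij_betw_inv_into_left[OF bij])
  have h_below: "h w \<in> polys_below n" if "w \<in> carrier_vec n" for w
    using bij_betwE[OF bij_h] that by blast
  have bij_R: "bij_betw R (polys_below n) (primary_sum lam)"
  proof -
    have "bij_betw ((\<lambda>u i. if i \<in> S \<times> {0} then u (fst i) else 0) \<circ> (\<lambda>g. \<lambda>\<phi>\<in>S. g mod \<phi>)) (polys_below n) (primary_sum lam)"
      by (rule bij_betw_trans[OF bij_betw_residues[OF S'(1,2), unfolded S'(3)] bij_betw_primary_sum[OF idx S'(1)]])
        (use mod nz in simp)
    moreover have "(\<lambda>u i. if i \<in> S \<times> {0} then u (fst i) else 0) \<circ> (\<lambda>g. \<lambda>\<phi>\<in>S. g mod \<phi>) = R"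
      by (auto simp: R_def fun_eq_iff)
    ultimately show ?thesis by simp
  qed
  have "primary_isomorphism A lam (R \<circ> h)"
    unfolding primary_isomorphism_def Let_def carrier_matD(1)[OF A'] comp_def
  proof (intro conjI ballI allI)
    show "bij_betw (\<lambda>w. R (h w)) (carrier_vec n) (primary_sum lam)"
      using bij_betw_trans[OF bij_h bij_R] by (simp add: comp_def)
  next
    fix w w' :: "'a Matrix.vec" assume w: "w \<in> carrier_vec n" "w' \<in> carrier_vec n"
    have "h (w + w') = h w + h w'"
    proof (rule h_eqI)
      show "h w + h w' \<in> polys_below n" using h_below w by (simp add: polys_below_def)
      show "?act (h w + h w') = w + w'" using poly_act_add[OF A' v(1)] act_h w by simp
    qed
    then show "R (h (w + w')) = (\<lambda>i. R (h w) i + R (h w') i)" by (simp add: R_def fun_eq_iff poly_mod_add_left)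
  next
    fix c and w :: "'a Matrix.vec" assume w: "w \<in> carrier_vec n"
    have "h (c \<cdot>\<^sub>v w) = Polynomial.smult c (h w)"
    proof (rule h_eqI)
      show "Polynomial.smult c (h w) \<in> polys_below n" using h_below w by (simp add: polys_below_def)
      show "?act (Polynomial.smult c (h w)) = c \<cdot>\<^sub>v w" using poly_act_smult[OF A' v(1)] act_h w by simp
    qed
    then show "R (h (c \<cdot>\<^sub>v w)) = (\<lambda>i. Polynomial.smult c (R (h w) i))" by (simp add: R_def fun_eq_iff mod_smult_left)
  next
    fix w :: "'a Matrix.vec" assume w: "w \<in> carrier_vec n"
    have h_A: "h (A *\<^sub>v w) = ?z * h w mod ?f"
    proof (rule h_eqI)
      show "?z * h w mod ?f \<in> polys_below n" using mod_in_polys_below[OF S'(6), of "?z * h w"] S'(5) by simp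
      have "?act (?z * h w mod ?f) = ?act (?z * h w)" by (rule poly_act_mod[OF A' v(1,3)])
      also have "\<dots> = ?act (pCons 0 (h w))" by simp
      also have "\<dots> = A *\<^sub>v w" using poly_act_pCons[OF A' v(1)] act_h[OF w] v(1) w A' by (simp add: smult_zero_vec)
      finally show "?act (?z * h w mod ?f) = A *\<^sub>v w" .
    qed
    show "R (h (A *\<^sub>v w)) = z_action lam (R (h w))"
    proof (rule ext)
      fix i :: "'a poly \<times> nat"
      show "R (h (A *\<^sub>v w)) i = z_action lam (R (h w)) i"
      proof (cases "i \<in> S \<times> {0}")
        case True
        then obtain \<phi> where \<phi>: "i = (\<phi>, 0)" "\<phi> \<in> S" by auto
        have "\<phi> dvd ?f" by (rule dvd_prod_eqI[OF S'(1) \<phi>(2) refl])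
        have "R (h (A *\<^sub>v w)) i = (?z * h w mod ?f) mod \<phi>" unfolding R_def h_A using \<phi> by simp
        also have "\<dots> = (?z * h w) mod \<phi>" using \<open>\<phi> dvd ?f\<close> by (rule mod_mod_cancel)
        also have "\<dots> = (?z * (h w mod \<phi>)) mod \<phi>" by (rule mod_mult_right_eq[symmetric])
        also have "\<dots> = z_action lam (R (h w)) i"
          unfolding z_action_def \<phi>(1) mod[OF \<phi>(2)] using \<phi>(2) by (simp add: R_def)
        finally show ?thesis .
      next
        case False
        then show ?thesis by (simp add: z_action_def R_def)
      qed
    qed
  qed
  moreover have "partition_list (lam \<phi>)" and "length (lam \<phi>) \<le> 1" for \<phi>
    by (simp_all add: lam_def partition_list_def)
  ultimately show ?thesis unfolding regular_mat_def has_primary_partitions_def by blast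
qed

text \<open>Regularity makes the module a sum of one F[z]/(\<phi>^e) for each \<phi> in S. Its
  all-ones element is the candidate cyclic vector v: p kills v exactly when every \<phi>^e divides
  p. Semisimplicity then forces e = 1, so the annihilator of v is generated by
  \<open>\<Prod>S\<close>.\<close>

lemma regular_semisimple_imp_cyclic_mats:
  fixes A :: "'a::{field,finite} mat"
  assumes A: "A \<in> carrier_mat n n" and reg: "regular_mat A" and ss: "semisimple_mat A"
  shows "\<exists>S\<in>irreducible_sets n. A \<in> cyclic_mats (\<Prod>S)"
proof -
  obtain lam T where part: "\<And>\<phi>. \<phi> \<in> monic_irreducibles \<Longrightarrow> partition_list (lam \<phi>)"
    and len: "\<And>\<phi>. \<phi> \<in> monic_irreducibles \<Longrightarrow> length (lam \<phi>) \<le> 1"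
    and iso: "primary_isomorphism A lam T"
    using reg by (auto simp: regular_mat_def has_primary_partitions_def)
  have bij: "bij_betw T (carrier_vec n) (primary_sum lam)"
    and T_add: "\<And>v w. v \<in> carrier_vec n \<Longrightarrow> w \<in> carrier_vec n \<Longrightarrow> T (v + w) = (\<lambda>i. T v i + T w i)"
    and T_smult: "\<And>c v. v \<in> carrier_vec n \<Longrightarrow> T (c \<cdot>\<^sub>v v) = (\<lambda>i. Polynomial.smult c (T v i))"
    and T_z: "\<And>v. v \<in> carrier_vec n \<Longrightarrow> T (A *\<^sub>v v) = z_action lam (T v)"
    using iso A by (auto simp: primary_isomorphism_def Let_def)
  define S where "S = {\<phi> \<in> monic_irreducibles. lam \<phi> \<noteq> []}"
  define e where "e = (\<lambda>\<phi>. lam \<phi> ! 0)"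
  have S_sub: "S \<subseteq> monic_irreducibles" by (auto simp: S_def)
  have lam_S: "lam \<phi> = [e \<phi>] \<and> e \<phi> > 0" if "\<phi> \<in> S" for \<phi>
    using that len[of \<phi>] part[of \<phi>] by (cases "lam \<phi>") (auto simp: S_def e_def partition_list_def)
  have idx: "summand_index lam = S \<times> {0}"
  proof -
    have "{..<length (lam \<phi>)} = (if \<phi> \<in> S then {0} else {})" if "\<phi> \<in> monic_irreducibles" for \<phi>
      using that lam_S[of \<phi>] by (auto simp: S_def)
    then have "summand_index lam = (SIGMA \<phi>:monic_irreducibles. if \<phi> \<in> S then {0} else {})"
      unfolding summand_index_def by (intro Sigma_cong refl)
    then show ?thesis using S_sub by (auto split: if_splits)
  qed
  have modulus: "summand_modulus lam (\<phi>, 0) = \<phi> ^ e \<phi>" for \<phi> by (simp add: summand_modulus_def e_def)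
  note irr = monic_irreduciblesD[OF subsetD[OF S_sub]]
  have mod_nz: "\<phi> ^ e \<phi> \<noteq> 0" and deg_pos: "Polynomial.degree (\<phi> ^ e \<phi>) > 0" if "\<phi> \<in> S" for \<phi>
    using irr[OF that] lam_S[OF that] by (simp_all add: degree_power_eq)
  have const_mod: "[:c:] mod \<phi> ^ e \<phi> = [:c:]" if "\<phi> \<in> S" for c \<phi>
    using deg_pos[OF that] by (intro mod_poly_less) simp
  have fin: "finite S"
  proof -
    \<comment> \<open>Families with the single entry 1 at \<phi> embed S into
      \<open>primary_sum lam\<close>, which is finite by its bijection with F^n.\<close>
    let ?g = "\<lambda>\<phi> i. if i = (\<phi>, 0) then 1 else (0 :: 'a poly)"
    have "?g \<phi> \<in> primary_sum lam" if "\<phi> \<in> S" for \<phi>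
      using that const_mod[OF that, of 1] by (auto simp: primary_sum_def idx modulus one_pCons)
    then have "?g ` S \<subseteq> primary_sum lam" by (rule image_subsetI)
    moreover have "inj_on ?g S" by (rule inj_onI) (metis one_neq_zero prod.inject)
    moreover have "finite (primary_sum lam)" using bij_betw_finite[OF bij] finite_carrier_vec by blast
    ultimately show ?thesis by (intro inj_on_finite[of ?g S "primary_sum lam"])
  qed
  have deg: "(\<Sum>\<phi>\<in>S. Polynomial.degree (\<phi> ^ e \<phi>)) = n"
  proof -
    \<comment> \<open>Dimensions are compared through cardinalities, both of them powers of
      q.\<close>
    have "CARD('a) ^ n = card (primary_sum lam)" using bij_betw_same_card[OF bij] by (simp add: card_carrier_vec)
    also have "\<dots> = card (PiE S (\<lambda>\<phi>. polys_below (Polynomial.degree (\<phi> ^ e \<phi>))) :: ('a poly \<Rightarrow> 'a poly) set)"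
      using bij_betw_same_card[OF bij_betw_primary_sum[OF idx fin, of "\<lambda>\<phi>. \<phi> ^ e \<phi>"]] modulus mod_nz by simp
    also have "\<dots> = CARD('a) ^ (\<Sum>\<phi>\<in>S. Polynomial.degree (\<phi> ^ e \<phi>))"
      using fin by (simp add: card_PiE card_polys_below power_sum)
    finally have "CARD('a) ^ n = CARD('a) ^ (\<Sum>\<phi>\<in>S. Polynomial.degree (\<phi> ^ e \<phi>))" .
    moreover have "CARD('a) > 1" using card_mono[of UNIV "{0, 1::'a}"] by simp
    ultimately show ?thesis using power_inject_exp by simp
  qed
  \<comment> \<open>The all-ones family generates the sum, since the moduli are powers of distinct
    irreducibles. It is a reduced representative because every modulus has positive degree.\<close>
  have "(\<lambda>i. if i \<in> S \<times> {0} then 1 else 0) \<in> primary_sum lam"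
    using const_mod[of _ 1] fin by (auto simp: primary_sum_def idx modulus one_pCons)
  then have "(\<lambda>i. if i \<in> S \<times> {0} then 1 else 0) \<in> T ` carrier_vec n"
    unfolding bij_betw_imp_surj_on[OF bij] .
  then obtain v where v: "v \<in> carrier_vec n" and Tv: "T v = (\<lambda>i. if i \<in> S \<times> {0} then 1 else 0)"
    by (elim imageE) simp
  have T_0: "T (0\<^sub>v n) = (\<lambda>i. 0)" using T_smult[of "0\<^sub>v n" 0] by (simp add: smult_vec_zero)
  have T_act: "T (poly_act A p v) = (\<lambda>i. if i \<in> S \<times> {0} then p mod (fst i ^ e (fst i)) else 0)" for p
  proof (induction p)
    case 0
    then show ?case using T_0 v by (simp add: fun_eq_iff)
  next
    case (pCons a p)
    have "T (poly_act A (pCons a p) v) i = (if i \<in> S \<times> {0} then pCons a p mod (fst i ^ e (fst i)) else 0)" for i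
    proof (cases "i \<in> S \<times> {0}")
      case True
      then obtain \<phi> where \<phi>: "i = (\<phi>, 0)" "\<phi> \<in> S" by auto
      have "T (poly_act A (pCons a p) v) i = Polynomial.smult a (T v i) + z_action lam (T (poly_act A p v)) i"
        using A v T_add T_smult T_z by (simp add: poly_act_pCons)
      also have "\<dots> = [:a:] + [:0, 1:] * (p mod \<phi> ^ e \<phi>) mod \<phi> ^ e \<phi>"
        unfolding Tv pCons.IH using \<phi> by (simp add: z_action_def modulus)
      also have "\<dots> = ([:a:] + [:0, 1:] * p) mod \<phi> ^ e \<phi>"
        unfolding mod_mult_right_eq poly_mod_add_left const_mod[OF \<phi>(2)] ..
      also have "[:a:] + [:0, 1:] * p = pCons a p" by simp
      finally show ?thesis using \<phi> by simp
    next
      case False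
      have "poly_act A (pCons a p) v \<in> carrier_vec n" using A v by simp
      then have "T (poly_act A (pCons a p) v) \<in> primary_sum lam" using bij_betwE[OF bij] by blast
      then have "T (poly_act A (pCons a p) v) i = 0" using False unfolding primary_sum_def idx by blast
      then show ?thesis using False by simp
    qed
    then show ?case by (rule ext)
  qed
  have act_0: "poly_act A p v = 0\<^sub>v n \<longleftrightarrow> (\<forall>\<phi>\<in>S. \<phi> ^ e \<phi> dvd p)" for p
  proof -
    have "poly_act A p v = 0\<^sub>v n \<longleftrightarrow> T (poly_act A p v) = T (0\<^sub>v n)"
      using inj_on_eq_iff[OF bij_betw_imp_inj_on[OF bij]] A v by simp
    then show ?thesis unfolding T_act T_0 by (auto simp: fun_eq_iff dvd_eq_mod_eq_0)
  qed
  \<comment> \<open>The sum of the exponents is a common upper bound for them, so this single power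
    of \<open>\<Prod>S\<close> is divisible by every \<phi>^e; semisimplicity then removes the
    power.\<close>
  have "poly_act A (\<Prod>S ^ (\<Sum>\<phi>\<in>S. e \<phi>)) v = 0\<^sub>v n"
    unfolding act_0
  proof
    fix \<phi> assume \<phi>: "\<phi> \<in> S"
    have "\<phi> ^ e \<phi> dvd \<phi> ^ (\<Sum>\<phi>\<in>S. e \<phi>)" using \<phi> fin by (intro le_imp_power_dvd member_le_sum) auto
    also have "\<dots> dvd \<Prod>S ^ (\<Sum>\<phi>\<in>S. e \<phi>)" by (intro dvd_power_same dvd_prod_eqI[OF fin \<phi> refl])
    finally show "\<phi> ^ e \<phi> dvd \<Prod>S ^ (\<Sum>\<phi>\<in>S. e \<phi>)" .
  qed
  then have act_prod: "poly_act A (\<Prod>S) v = 0\<^sub>v n" by (rule semisimple_mat_radical[OF A ss v])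
  have e1: "e \<phi> = 1" if \<phi>: "\<phi> \<in> S" for \<phi>
  proof (rule ccontr)
    assume "e \<phi> \<noteq> 1"
    then have "2 \<le> e \<phi>" using lam_S[OF \<phi>] by simp
    then have "\<phi> ^ 2 dvd \<Prod>S" using act_prod \<phi> unfolding act_0 by (meson dvd_trans le_imp_power_dvd)
    then have "\<phi> * \<phi> dvd \<phi> * \<Prod>(S - {\<phi>})" unfolding prod.remove[OF fin \<phi>] by (simp add: power2_eq_square)
    then have "\<phi> dvd \<Prod>(S - {\<phi>})" using irr(2)[OF \<phi>] by simp
    then show False using dvd_prod_monic_irreducibles_iff[of "S - {\<phi>}" \<phi>] fin S_sub \<phi> by blast
  qed
  then have S: "S \<in> irreducible_sets n" using fin S_sub deg by (simp add: irreducible_sets_def)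
  have "cyclic_vec A v" unfolding cyclic_vec_def
  proof (intro ballI impI)
    fix p assume p: "p \<in> polys_below (dim_row A)" "poly_act A p v = 0\<^sub>v (dim_row A)"
    then have "\<forall>\<phi>\<in>S. \<phi> dvd p" using act_0[of p] e1 A by simp
    then have "\<Prod>S dvd p" using prod_monic_irreducibles_dvd[OF fin S_sub] by blast
    then show "p = 0" using prod_irreducible_set_dvd_imp_0[OF S] p(1) A by simp
  qed
  then have "A \<in> cyclic_mats (\<Prod>S)"
    using A v act_prod irreducible_setsD(5)[OF S] unfolding cyclic_mats_def by blast
  then show ?thesis using S by blast
qed

section \<open>The probability and its limit\<close>

lemma regular_semisimple_mat_iff:
  fixes A :: "'a::{field,finite} mat"
  assumes "A \<in> carrier_mat n n"
  shows "regular_semisimple_mat A \<longleftrightarrow> (\<exists>S\<in>irreducible_sets n. A \<in> cyclic_mats (\<Prod>S))"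
  unfolding regular_semisimple_mat_def
  using regular_semisimple_imp_cyclic_mats[OF assms] regular_cyclic_mats semisimple_cyclic_mats by blast

text \<open>The classes \<open>cyclic_mats (\<Prod>S)\<close> partition the regular-semisimple
  matrices: a matrix determines its monic polynomial, and S is recovered as the set of monic
  irreducible divisors. The number of invertible matrices is common to all classes and comes out of
  the sum.\<close>

lemma prob_regular_semisimple:
  assumes n: "n > 0"
  shows "measure_pmf.prob (pmf_of_set (carrier_mat n n :: 'a::{field,finite} mat set)) {A. regular_semisimple_mat A} =
    (\<Prod>r<n. 1 - 1 / real CARD('a) ^ Suc r) *
    (\<Sum>S\<in>(irreducible_sets n :: 'a poly set set). \<Prod>\<phi>\<in>S. 1 / (real CARD('a) ^ Polynomial.degree \<phi> - 1))"
proof -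
  let ?M = "carrier_mat n n :: 'a mat set" and ?I = "irreducible_sets n :: 'a poly set set"
  have fin_I: "finite ?I"
    unfolding irreducible_sets_eq using finite_monic_irreducibles_degree_le[where 'a='a, of n] by simp
  have X: "cyclic_mats (\<Prod>S) \<subseteq> ?M" if "S \<in> ?I" for S
    using irreducible_setsD(5)[OF that] by (auto simp: cyclic_mats_def)
  have eq: "?M \<inter> {A. regular_semisimple_mat A} = (\<Union>S\<in>?I. cyclic_mats (\<Prod>S))"
    using regular_semisimple_mat_iff X by blast
  have disj: "cyclic_mats (\<Prod>S) \<inter> cyclic_mats (\<Prod>R) = {}" if "S \<in> ?I" "R \<in> ?I" "S \<noteq> R" for S R
  proof (rule ccontr)
    assume "cyclic_mats (\<Prod>S) \<inter> cyclic_mats (\<Prod>R) \<noteq> {}"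
    then obtain A where A: "A \<in> cyclic_mats (\<Prod>S)" "A \<in> cyclic_mats (\<Prod>R)" by blast
    note SD = irreducible_setsD[OF that(1)] and RD = irreducible_setsD[OF that(2)]
    have prod: "\<Prod>S = \<Prod>R" by (rule cyclic_mats_disjoint[OF A _ SD(4) RD(4)]) (simp only: SD(5) RD(5))
    have "\<phi> \<in> S \<longleftrightarrow> \<phi> \<in> R" for \<phi>
    proof (cases "\<phi> \<in> monic_irreducibles")
      case True
      then show ?thesis
        using dvd_prod_monic_irreducibles_iff[OF SD(1,2) True] dvd_prod_monic_irreducibles_iff[OF RD(1,2) True] prod by simp
    qed (use SD(2) RD(2) in blast)
    then show False using that(3) by blast
  qed
  have "real (card (?M \<inter> {A. regular_semisimple_mat A})) = (\<Sum>S\<in>?I. real (card (cyclic_mats (\<Prod>S))))"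
    unfolding eq of_nat_sum[symmetric]
    by (intro arg_cong[where f = real] card_UN_disjoint fin_I ballI impI disj finite_subset[OF X finite_carrier_mat])
  also have "\<dots> = real (card (injective_mats n n :: 'a mat set)) *
      (\<Sum>S\<in>?I. \<Prod>\<phi>\<in>S. 1 / (real CARD('a) ^ Polynomial.degree \<phi> - 1))"
    unfolding sum_distrib_left by (intro sum.cong refl card_cyclic_mats n)
  finally have card: "real (card (?M \<inter> {A. regular_semisimple_mat A})) = \<dots>" .
  have "?M \<noteq> {}" using zero_carrier_mat by blast
  then have "measure_pmf.prob (pmf_of_set ?M) {A. regular_semisimple_mat A} =
      real (card (?M \<inter> {A. regular_semisimple_mat A})) / real (card ?M)"
    using finite_carrier_mat by (rule measure_pmf_of_set)
  also have "real (card ?M) = real CARD('a) ^ (n * n)" by (simp add: card_carrier_mat)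
  finally show ?thesis unfolding card card_injective_mats_fraction[where 'a='a, symmetric] by simp
qed

theorem theorem5:
  fixes q :: nat
  assumes "primepow q"
    and "CARD('a::{field,finite}) = q"
  shows "(\<lambda>n. measure_pmf.prob (pmf_of_set (carrier_mat n n :: 'a mat set))
              {A. regular_semisimple_mat A})
           \<longlonglongrightarrow> (\<Prod>r. 1 - 1 / real q ^ Suc r)"
proof -
  have q: "real q > 1"
    using card_mono[of UNIV "{0, 1::'a}"] assms(2) by simp
  have "convergent_prod (\<lambda>r. 1 - 1 / real q ^ Suc r)"
  proof (intro abs_convergent_prod_imp_convergent_prod summable_imp_abs_convergent_prod)
    have "summable (\<lambda>r. inverse (real q) * inverse (real q) ^ r)"
      using q by (intro summable_mult summable_geometric) (simp add: inverse_less_1_iff)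
    then show "summable (\<lambda>r. norm (1 - 1 / real q ^ Suc r - 1))" using q by (simp add: field_simps)
  qed
  then have "(\<lambda>n. \<Prod>r\<le>n. 1 - 1 / real q ^ Suc r) \<longlonglongrightarrow> (\<Prod>r. 1 - 1 / real q ^ Suc r)"
    by (rule convergent_prod_LIMSEQ)
  \<comment> \<open>Index shift: the partial products so far include r = n, whereas the fraction of
    invertible matrices stops at r = n - 1.\<close>
  then have "(\<lambda>n. \<Prod>r<n. 1 - 1 / real q ^ Suc r) \<longlonglongrightarrow> (\<Prod>r. 1 - 1 / real q ^ Suc r)"
    unfolding lessThan_Suc_atMost[symmetric] by (rule LIMSEQ_imp_Suc[of "\<lambda>n. \<Prod>r<n. 1 - 1 / real q ^ Suc r"])
  from tendsto_mult[OF this squarefree_sum_tendsto_1[where 'a='a]]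
  have "(\<lambda>n. (\<Prod>r<n. 1 - 1 / real q ^ Suc r) *
      (\<Sum>S\<in>(irreducible_sets n :: 'a poly set set). \<Prod>\<phi>\<in>S. 1 / (real q ^ Polynomial.degree \<phi> - 1)))
    \<longlonglongrightarrow> (\<Prod>r. 1 - 1 / real q ^ Suc r)"
    using assms(2) by simp
  \<comment> \<open>The formula for the probability is available for n > 0, which is enough for the
    limit.\<close>
  then show ?thesis
  proof (rule Lim_transform_eventually)
    show "\<forall>\<^sub>F n in sequentially. (\<Prod>r<n. 1 - 1 / real q ^ Suc r) *
        (\<Sum>S\<in>(irreducible_sets n :: 'a poly set set). \<Prod>\<phi>\<in>S. 1 / (real q ^ Polynomial.degree \<phi> - 1)) =
      measure_pmf.prob (pmf_of_set (carrier_mat n n :: 'a mat set)) {A. regular_semisimple_mat A}"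
      using eventually_gt_at_top[of 0] by eventually_elim (simp add: prob_regular_semisimple assms(2))
  qed
qed

end
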